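(* Let $\Gamma=(V,E)$ be a metric graph with total length $L(\Gamma)$ and length of the longest edge $\ell_{\max}$, and let $p\in[1,\infty]$. Then, for any $q\in L^p(\Gamma)$ and any coupling strengths $\{\alpha_v\in\mathbb R\cup\{\infty\}: v\in V\}$, one has $$\lambda_1(H_q)\le\left(\frac{2}{\ell_{\max}}\right)^{1/p}\|q_+\|_{L^p(\Gamma)}+\left(\frac{\pi}{\ell_{\max}}\right)^2.$$ Moreover, $$\lambda_1(H_q)\le\left(\frac{2|E|}{L(\Gamma)}\right)^{1/p}\|q_+\|_{L^p(\Gamma)}+\left(\frac{\pi|E|}{L(\Gamma)}\right)^2.$$
   Context: A metric graph $\Gamma=(V,E)$ is a finite graph (not necessarily connected, loops and multiple edges allowed, every vertex is an endpoint of some edge, at least one edge) in which each edge $e\in E$ is identified with an interval $[0,\ell_e]$ of finite length $\ell_e>0$, endpoints of intervals being glued at the vertices. $L(\Gamma)=\sum_{e\in E}\ell_e$, $\ell_{\max}=\max_e\ell_e$. $L^p(\Gamma)$ is taken with respect to the Lebesgue measure on the edges. Convention: $1/p=0$ if $p=\infty$. For a function $q$, $q_+=\max(q,0)$. All functions are real-valued. $W^{1,2}(\Gamma)$ is the space of functions in $\bigoplus_{e\in E}W^{1,2}(e)$ that are continuous on $\Gamma$. Given $q\in L^1(\Gamma)$ and coupling strengths $\alpha_v\in\mathbb R\cup\{\infty\}$ ($v\in V$), the Schrödinger operator $H_qf=-f''+qf$ is considered with the following vertex conditions: $f$ is continuous on $\Gamma$; at each $v$ with $\alpha_v\in\mathbb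 R$, $\sum_{e\in E_v}f_e'(v)=\alpha_vf(v)$, where $E_v$ is the set of edges attached to $v$ and $f_e'(v)$ is the derivative of $f$ at $v$ in the direction pointing out of $v$ into $e$; at each $v$ with $\alpha_v=\infty$, the Dirichlet condition $f(v)=0$. Its eigenvalues $\lambda_1(H_q)\le\lambda_2(H_q)\le\cdots\nearrow\infty$, counted with multiplicity, satisfy $$\lambda_k(H_q)=\min_{\substack{F\subset D\\ \dim F=k}}\ \max_{f\in F\setminus\{0\}}\frac{\int_\Gamma (f')^2\,dx+\sum_{v:\alpha_v<\infty}\alpha_vf(v)^2+\int_\Gamma qf^2\,dx}{\int_\Gamma f^2\,dx},$$ where $D=\{f\in W^{1,2}(\Gamma): f(v)=0 \text{ whenever }\alpha_v=\infty\}$. *)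

theory Defs
  imports "HOL-Analysis.Analysis" "Graph_Theory.Digraph"
begin

text \<open>
  The finite multigraph underlying a metric graph is a \<^locale>\<open>fin_digraph\<close>: it allows loops and
  multiple edges and need not be connected.  The orientation of an arc \<open>e\<close> only records the
  identification of the edge with \<open>[0, len e]\<close>: the endpoint \<open>0\<close> is glued at \<open>tail G e\<close> and the
  endpoint \<open>len e\<close> at \<open>head G e\<close>.
\<close>

locale metric_graph = fin_digraph G
  for G :: "('v, 'e) pre_digraph" (structure) +
  fixes len :: "'e \<Rightarrow> real"
  assumes arcs_nonempty: "arcs G \<noteq> {}"
    and no_isolated_verts: "v \<in> verts G \<Longrightarrow> \<exists>e\<in>arcs G. tail G e = v \<or> head G e = v"
    and len_pos: "e \<in> arcs G \<Longrightarrow> 0 < len e"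

definition total_length :: "('v, 'e) pre_digraph \<Rightarrow> ('e \<Rightarrow> real) \<Rightarrow> real" where
  "total_length G len = (\<Sum>e\<in>arcs G. len e)"

definition max_length :: "('v, 'e) pre_digraph \<Rightarrow> ('e \<Rightarrow> real) \<Rightarrow> real" where
  "max_length G len = Max (len ` arcs G)"

text \<open>
  A function on the metric graph is a family \<open>f :: 'e \<Rightarrow> real \<Rightarrow> real\<close>; only the values \<open>f e x\<close> with
  \<open>e \<in> arcs G\<close> and \<open>0 \<le> x \<le> len e\<close> matter.
\<close>

definition in_Lp ::
  "('v, 'e) pre_digraph \<Rightarrow> ('e \<Rightarrow> real) \<Rightarrow> ereal \<Rightarrow> ('e \<Rightarrow> real \<Rightarrow> real) \<Rightarrow> bool" where
  "in_Lp G len p f \<longleftrightarrow> (\<forall>e\<in>arcs G.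
     f e \<in> borel_measurable (lebesgue_on {0..len e}) \<and>
     (if p = \<infinity> then \<exists>C. AE x in lebesgue_on {0..len e}. \<bar>f e x\<bar> \<le> C
      else integrable (lebesgue_on {0..len e}) (\<lambda>x. \<bar>f e x\<bar> powr real_of_ereal p)))"

definition Lp_norm ::
  "('v, 'e) pre_digraph \<Rightarrow> ('e \<Rightarrow> real) \<Rightarrow> ereal \<Rightarrow> ('e \<Rightarrow> real \<Rightarrow> real) \<Rightarrow> real" where
  "Lp_norm G len p f =
     (if p = \<infinity> then Inf {C. 0 \<le> C \<and> (\<forall>e\<in>arcs G. AE x in lebesgue_on {0..len e}. \<bar>f e x\<bar> \<le> C)}
      else (\<Sum>e\<in>arcs G. LINT x|lebesgue_on {0..len e}. \<bar>f e x\<bar> powr real_of_ereal p)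
             powr (1 / real_of_ereal p))"

text \<open>
  \<open>f\<close> is absolutely continuous on \<open>[0, l]\<close> (that is, \<open>f \<in> W\<^sup>1\<^sup>,\<^sup>1\<close>) with weak derivative \<open>g\<close>.
  If \<open>g\<close> is continuous, it is the classical derivative of \<open>f\<close>, one-sided at \<open>0\<close> and \<open>l\<close>.
\<close>

definition has_ac_derivative :: "(real \<Rightarrow> real) \<Rightarrow> (real \<Rightarrow> real) \<Rightarrow> real \<Rightarrow> bool" where
  "has_ac_derivative f g l \<longleftrightarrow>
     g absolutely_integrable_on {0..l} \<and> (\<forall>x\<in>{0..l}. f x = f 0 + integral {0..x} g)"

text \<open>
  \<open>outgoing_derivative_sum G len f1 v\<close> is the sum over the edges attached to \<open>v\<close> of the derivatives
  at \<open>v\<close> pointing out of \<open>v\<close> into the edge, where \<open>f1\<close> is the edgewise derivative.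
  A loop at \<open>v\<close> contributes one term for each of its two ends.
\<close>

definition outgoing_derivative_sum ::
  "('v, 'e) pre_digraph \<Rightarrow> ('e \<Rightarrow> real) \<Rightarrow> ('e \<Rightarrow> real \<Rightarrow> real) \<Rightarrow> 'v \<Rightarrow> real" where
  "outgoing_derivative_sum G len f1 v =
     (\<Sum>e\<in>out_arcs G v. f1 e 0) + (\<Sum>e\<in>in_arcs G v. - f1 e (len e))"

text \<open>
  \<open>schroedinger G len \<alpha> q f h\<close>: the function \<open>f\<close> lies in the domain of the self-adjoint operator
  \<open>H\<^sub>q\<close> on \<open>L\<^sup>2\<close> and \<open>H\<^sub>q f = h\<close>.  Since \<open>q\<close> is merely integrable, the domain asks for
  \<open>f\<close> and \<open>f'\<close> to be absolutely continuous on every edge and for \<open>- f'' + q f\<close> to be in \<open>L\<^sup>2\<close>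
  (so that \<open>f\<close> is in \<open>W\<^sup>1\<^sup>,\<^sup>2\<close> automatically), besides the vertex conditions.
  Here \<open>f1 = f'\<close>, \<open>f2 = f''\<close>, and \<open>\<phi> v\<close> is the common value of \<open>f\<close> at \<open>v\<close>, whose existence
  expresses continuity at the vertices.
\<close>

definition schroedinger ::
  "('v, 'e) pre_digraph \<Rightarrow> ('e \<Rightarrow> real) \<Rightarrow> ('v \<Rightarrow> ereal) \<Rightarrow> ('e \<Rightarrow> real \<Rightarrow> real) \<Rightarrow>
   ('e \<Rightarrow> real \<Rightarrow> real) \<Rightarrow> ('e \<Rightarrow> real \<Rightarrow> real) \<Rightarrow> bool" where
  "schroedinger G len \<alpha> q f h \<longleftrightarrow> in_Lp G len 2 h \<and> (\<exists>f1 f2 \<phi>.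
     (\<forall>e\<in>arcs G.
        has_ac_derivative (f e) (f1 e) (len e) \<and>
        has_ac_derivative (f1 e) (f2 e) (len e) \<and>
        (AE x in lebesgue_on {0..len e}. h e x = - f2 e x + q e x * f e x) \<and>
        f e 0 = \<phi> (tail G e) \<and> f e (len e) = \<phi> (head G e)) \<and>
     (\<forall>v\<in>verts G.
        if \<alpha> v = \<infinity> then \<phi> v = 0
        else outgoing_derivative_sum G len f1 v = real_of_ereal (\<alpha> v) * \<phi> v))"

definition schroedinger_eigenvalue ::
  "('v, 'e) pre_digraph \<Rightarrow> ('e \<Rightarrow> real) \<Rightarrow> ('v \<Rightarrow> ereal) \<Rightarrow> ('e \<Rightarrow> real \<Rightarrow> real) \<Rightarrow> real \<Rightarrow> bool" where
  "schroedinger_eigenvalue G len \<alpha> q \<mu> \<longleftrightarrow>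
     (\<exists>f. schroedinger G len \<alpha> q f (\<lambda>e x. \<mu> * f e x) \<and>
          (\<exists>e\<in>arcs G. \<exists>x\<in>{0..len e}. f e x \<noteq> 0))"

text \<open>
  The spectrum of \<open>H\<^sub>q\<close> is discrete and bounded from below, so a least eigenvalue exists.
\<close>

definition lambda1 ::
  "('v, 'e) pre_digraph \<Rightarrow> ('e \<Rightarrow> real) \<Rightarrow> ('v \<Rightarrow> ereal) \<Rightarrow> ('e \<Rightarrow> real \<Rightarrow> real) \<Rightarrow> real" where
  "lambda1 G len \<alpha> q = (LEAST \<mu>. schroedinger_eigenvalue G len \<alpha> q \<mu>)"

end

theory Submission
  imports Defs "HOL-Complex_Analysis.Great_Picard"
begin

text \<open>
  Let \<open>\<mu>\<close> be the infimum of the Rayleigh quotient over functions that are \<open>C\<^sup>1\<close> on every edge.  By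
  Arzela--Ascoli a normalised minimising sequence has a uniform limit \<open>f\<close>, and by Cauchy--Schwarz
  for the nonnegative form \<open>Q - \<mu>\<close> its form products with any fixed test function tend to \<open>0\<close>.
  Integrating by parts onto a \<open>C\<^sup>2\<close> test function before passing to the limit avoids weak
  compactness and the completeness of \<open>L\<^sup>2\<close>: the limit equation says that \<open>f\<close> differs from a second
  antiderivative of \<open>(q - \<mu>) f\<close> by an affine function on every edge, so \<open>f\<close> is an eigenfunction.
  Conversely every eigenfunction is \<open>C\<^sup>1\<close> on the edges with Rayleigh quotient equal to its
  eigenvalue; hence \<open>\<mu>\<close> is the least eigenvalue.  The bound follows by testing with
  \<open>sin (\<pi> x / l)\<close> on the longest edge, of length \<open>l\<close>, and applying Jensen's inequality to the
  probability density \<open>(2 / l) sin\<^sup>2 (\<pi> x / l)\<close>; the second bound holds because the longest edge is at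
  least as long as the average edge.
\<close>

section \<open>One-dimensional analysis\<close>

lemma absolutely_integrable_mult_continuous:
  fixes k g :: "real \<Rightarrow> real"
  assumes "k absolutely_integrable_on {a..b}" "continuous_on {a..b} g"
  shows "(\<lambda>x. k x * g x) absolutely_integrable_on {a..b}"
proof -
  have "(\<lambda>x. g x * k x) absolutely_integrable_on {a..b}"
  proof (rule absolutely_integrable_bounded_measurable_product_real)
    show "g \<in> borel_measurable (lebesgue_on {a..b})"
      using assms(2) by (intro continuous_imp_measurable_on_sets_lebesgue) auto
    show "bounded (g ` {a..b})"
      using assms(2) compact_continuous_image compact_imp_bounded by blast
  qed (use assms in auto)
  then show ?thesis by (simp add: mult.commute)
qed

lemma integrable_mult_continuous:
  fixes k g :: "real \<Rightarrow> real"
  assumes "k absolutely_integrable_on {a..b}" "continuous_on {a..b} g"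
  shows "(\<lambda>x. k x * g x) integrable_on {a..b}"
  by (rule set_lebesgue_integral_eq_integral(1)[OF absolutely_integrable_mult_continuous[OF assms]])

lemma integral_split_real:
  fixes f :: "real \<Rightarrow> real"
  assumes "f integrable_on {a..b}" "a \<le> x" "x \<le> y" "y \<le> b"
  shows "integral {a..y} f = integral {a..x} f + integral {x..y} f"
  using assms(2-) integrable_on_subinterval[OF assms(1), of a y]
  by (intro Henstock_Kurzweil_Integration.integral_combine[symmetric]) auto

lemma has_integral_C1:
  fixes g g1 :: "real \<Rightarrow> real"
  assumes "\<And>x. x \<in> {a..b} \<Longrightarrow> (g has_real_derivative g1 x) (at x within {a..b})"
    and "a \<le> x" "x \<le> y" "y \<le> b"
  shows "(g1 has_integral g y - g x) {x..y}"
proof (rule fundamental_theorem_of_calculus)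
  fix t assume "t \<in> {x..y}"
  then have "(g has_vector_derivative g1 t) (at t within {a..b})"
    using assms by (auto simp flip: has_real_derivative_iff_has_vector_derivative)
  then show "(g has_vector_derivative g1 t) (at t within {x..y})"
    by (rule has_vector_derivative_within_subset) (use assms in auto)
qed (use assms in auto)

text \<open>The difference of the two sides, as a function of the right end point, has increments of
  order \<open>(y - x) * integral {x..y} \<bar>k\<bar>\<close>, so its derivative vanishes everywhere, although \<open>F\<close> need
  not be differentiable at any given point.\<close>

lemma integration_by_parts_ac:
  fixes k g g1 F :: "real \<Rightarrow> real"
  assumes ab: "a \<le> b"
    and k: "k absolutely_integrable_on {a..b}"
    and F: "\<And>x. x \<in> {a..b} \<Longrightarrow> F x = F a + integral {a..x} k"
    and g: "\<And>x. x \<in> {a..b} \<Longrightarrow> (g has_real_derivative g1 x) (at x within {a..b})"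
    and g1: "continuous_on {a..b} g1"
  shows "integral {a..b} (\<lambda>x. k x * g x) = F b * g b - F a * g a - integral {a..b} (\<lambda>x. F x * g1 x)"
proof -
  have ki: "k integrable_on {a..b}" and kai: "(\<lambda>x. \<bar>k x\<bar>) integrable_on {a..b}"
    using k by (auto simp: absolutely_integrable_on_def)
  define A where "A = (\<lambda>x. integral {a..x} (\<lambda>x. \<bar>k x\<bar>))"
  have contA: "continuous_on {a..b} A"
    unfolding A_def using kai by (rule indefinite_integral_continuous_1)
  have contF: "continuous_on {a..b} F"
  proof -
    have "continuous_on {a..b} (\<lambda>x. F a + integral {a..x} k)"
      by (intro continuous_intros indefinite_integral_continuous_1 ki)
    then show ?thesis by (rule continuous_on_eq) (rule F[symmetric])
  qed
  have contg: "continuous_on {a..b} g"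
    by (rule DERIV_continuous_on) (rule g)
  obtain C where C: "\<And>x. x \<in> {a..b} \<Longrightarrow> \<bar>g1 x\<bar> \<le> C" and C0: "0 \<le> C"
  proof -
    have "bounded (g1 ` {a..b})" using g1 compact_continuous_image compact_imp_bounded by blast
    then obtain C where "\<forall>x\<in>{a..b}. \<bar>g1 x\<bar> \<le> C" by (auto simp: bounded_iff)
    then show thesis using that[of "max C 0"] by (force simp: le_max_iff_disj)
  qed
  note kg = integrable_mult_continuous[OF k contg]
  have Fg: "(\<lambda>x. F x * g1 x) integrable_on {a..b}"
    by (intro integrable_continuous_real continuous_intros contF g1)
  \<comment> \<open>Up to the constant \<open>F a * g a\<close>, this is the left side minus the
    right side of the claim with \<open>b\<close> replaced by a variable right end point.\<close>
  define \<Phi> where "\<Phi> = (\<lambda>x. integral {a..x} (\<lambda>x. k x * g x) - F x * g x + integral {a..x} (\<lambda>x. F x * g1 x))"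
  have incr: "\<bar>\<Phi> y - \<Phi> x\<bar> \<le> 2 * C * (y - x) * (A y - A x)" if "a \<le> x" "x \<le> y" "y \<le> b" for x y
  proof -
    have sub: "{x..y} \<subseteq> {a..b}" using that by auto
    have ki': "k integrable_on {x..y}" "(\<lambda>x. k x * g x) integrable_on {x..y}"
      "(\<lambda>x. F x * g1 x) integrable_on {x..y}" "(\<lambda>x. \<bar>k x\<bar>) integrable_on {x..y}"
      "g1 integrable_on {x..y}"
      using sub by (auto intro: integrable_on_subinterval[OF ki] integrable_on_subinterval[OF kg]
        integrable_on_subinterval[OF Fg] integrable_on_subinterval[OF kai]
        integrable_on_subinterval[OF integrable_continuous_real[OF g1]])
    have A': "A y - A x = integral {x..y} (\<lambda>x. \<bar>k x\<bar>)"
      unfolding A_def using integral_split_real[OF kai that] by simp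
    have F': "F y - F x = integral {x..y} k" if "a \<le> x" "x \<le> y" "y \<le> b" for x y
      using F[of x] F[of y] that integral_split_real[OF ki that] by auto
    have g': "(g1 has_integral g y - g x) {x..y}"
      by (rule has_integral_C1[OF g that])
    \<comment> \<open>From \<open>F y * g y - F x * g x = g y * (F y - F x) + F x * (g y - g
      x)\<close>, where both increments are integrals: \<open>g\<close> gets compared with its value
      at \<open>y\<close>, and \<open>F\<close> with its value at \<open>x\<close>.\<close>
    have e1: "((\<lambda>t. k t * g t - g y * k t + (F t * g1 t - F x * g1 t)) has_integral
       (integral {x..y} (\<lambda>x. k x * g x) - g y * (F y - F x) +
         (integral {x..y} (\<lambda>x. F x * g1 x) - F x * (g y - g x)))) {x..y}"
      unfolding F'[OF that]
      by (intro has_integral_add has_integral_diff has_integral_mult_right g' integrable_integral ki')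
    have e2: "\<Phi> y - \<Phi> x = integral {x..y} (\<lambda>t. k t * g t - g y * k t + (F t * g1 t - F x * g1 t))"
      unfolding integral_unique[OF e1] \<Phi>_def
      using integral_split_real[OF kg that] integral_split_real[OF Fg that]
      by (simp add: algebra_simps)
    have bd: "\<bar>k t * g t - g y * k t + (F t * g1 t - F x * g1 t)\<bar>
        \<le> C * (y - x) * \<bar>k t\<bar> + C * (A y - A x)" if t: "t \<in> {x..y}" for t
    proof -
      have "\<bar>g y - g t\<bar> \<le> C * (y - x)"
      proof -
        have "\<bar>g y - g t\<bar> \<le> C * (y - t)"
        proof -
          have h: "(g1 has_integral g y - g t) {t..y}"
            by (rule has_integral_C1[OF g]) (use t that \<open>a \<le> x\<close> \<open>y \<le> b\<close> in auto)
          have "norm (integral {t..y} g1) \<le> integral {t..y} (\<lambda>_. C)"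
            by (rule integral_norm_bound_integral[OF has_integral_integrable[OF h]])
              (use t C \<open>a \<le> x\<close> \<open>y \<le> b\<close> in auto)
          then show ?thesis using h t by (simp add: integral_unique mult.commute)
        qed
        also have "\<dots> \<le> C * (y - x)" using t C0 by (intro mult_left_mono) auto
        finally show ?thesis .
      qed
      then have b1: "\<bar>k t * (g t - g y)\<bar> \<le> C * (y - x) * \<bar>k t\<bar>"
        by (simp add: abs_mult abs_minus_commute mult.commute mult_left_mono)
      have "\<bar>F t - F x\<bar> \<le> A y - A x"
      proof -
        have xt: "{x..t} \<subseteq> {x..y}" using t by auto
        note kt = integrable_on_subinterval[OF ki'(1) xt] integrable_on_subinterval[OF ki'(4) xt]
        have "norm (integral {x..t} k) \<le> integral {x..t} (\<lambda>x. \<bar>k x\<bar>)"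
          by (rule integral_norm_bound_integral[OF kt]) simp
        also have "\<dots> \<le> integral {x..y} (\<lambda>x. \<bar>k x\<bar>)"
          by (rule integral_subset_le[OF xt kt(2) ki'(4)]) simp
        finally show ?thesis using F'[of x t] t \<open>a \<le> x\<close> \<open>y \<le> b\<close> A' by auto
      qed
      then have b2: "\<bar>(F t - F x) * g1 t\<bar> \<le> C * (A y - A x)"
        unfolding abs_mult using C[of t] t sub by (subst mult.commute) (intro mult_mono, auto simp: C0)
      have "k t * g t - g y * k t + (F t * g1 t - F x * g1 t) = k t * (g t - g y) + (F t - F x) * g1 t"
        by (simp add: algebra_simps)
      then show ?thesis using b1 b2 by linarith
    qed
    have hb: "((\<lambda>t. C * (y - x) * \<bar>k t\<bar> + C * (A y - A x)) has_integral
       (C * (y - x) * (A y - A x) + (y - x) *\<^sub>R (C * (A y - A x)))) {x..y}"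
    proof (intro has_integral_add has_integral_mult_right)
      show "((\<lambda>x. \<bar>k x\<bar>) has_integral A y - A x) {x..y}"
        unfolding A' by (intro integrable_integral ki')
      show "((\<lambda>t. C * (A y - A x)) has_integral (y - x) *\<^sub>R (C * (A y - A x))) {x..y}"
        using has_integral_const_real[of "C * (A y - A x)" x y] that by simp
    qed
    have "norm (integral {x..y} (\<lambda>t. k t * g t - g y * k t + (F t * g1 t - F x * g1 t)))
       \<le> integral {x..y} (\<lambda>t. C * (y - x) * \<bar>k t\<bar> + C * (A y - A x))"
      by (rule integral_norm_bound_integral[OF has_integral_integrable[OF e1] has_integral_integrable[OF hb]])
        (use bd in auto)
    then show ?thesis unfolding e2 integral_unique[OF hb] by (simp add: algebra_simps)
  qed
  have incr': "\<bar>\<Phi> y - \<Phi> x\<bar> \<le> 2 * C * \<bar>y - x\<bar> * \<bar>A y - A x\<bar>" if "x \<in> {a..b}" "y \<in> {a..b}" for x y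
  proof (cases "x \<le> y")
    case True
    have "2 * C * (y - x) * (A y - A x) \<le> 2 * C * \<bar>y - x\<bar> * \<bar>A y - A x\<bar>"
      unfolding abs_of_nonneg[of "y - x", OF iffD2[OF diff_ge_0_iff_ge True]]
      by (rule mult_left_mono) (use C0 True in auto)
    then show ?thesis using incr[of x y] that True by auto
  next
    case False
    have xy: "\<bar>y - x\<bar> = x - y" using False by simp
    have "2 * C * (x - y) * (A x - A y) \<le> 2 * C * \<bar>y - x\<bar> * \<bar>A y - A x\<bar>"
      unfolding xy by (rule mult_left_mono) (use C0 False in auto)
    then show ?thesis using incr[of y x] that False by auto
  qed
  have "\<exists>c. \<forall>x\<in>{a..b}. \<Phi> x = c"
  proof (rule has_field_derivative_zero_constant)
    fix x assume x: "x \<in> {a..b}"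
    have "((\<lambda>y. A y) \<longlongrightarrow> A x) (at x within {a..b})"
      using contA x by (auto simp: continuous_on_def)
    then have "((\<lambda>y. 2 * C * \<bar>A y - A x\<bar>) \<longlongrightarrow> 2 * C * \<bar>A x - A x\<bar>) (at x within {a..b})"
      by (intro tendsto_intros)
    then have lim: "((\<lambda>y. 2 * C * \<bar>A y - A x\<bar>) \<longlongrightarrow> 0) (at x within {a..b})" by simp
    have "\<forall>\<^sub>F y in at x within {a..b}. norm ((\<Phi> y - \<Phi> x) / (y - x)) \<le> 2 * C * \<bar>A y - A x\<bar>"
      unfolding eventually_at_filter
    proof (intro always_eventually allI impI)
      fix y assume "y \<noteq> x" "y \<in> {a..b}"
      then show "norm ((\<Phi> y - \<Phi> x) / (y - x)) \<le> 2 * C * \<bar>A y - A x\<bar>"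
        using incr'[OF x, of y] by (simp add: divide_simps mult_ac)
    qed
    then have "((\<lambda>y. (\<Phi> y - \<Phi> x) / (y - x)) \<longlongrightarrow> 0) (at x within {a..b})"
      using lim by (rule Lim_null_comparison)
    then show "(\<Phi> has_real_derivative 0) (at x within {a..b})"
      by (simp add: has_field_derivative_iff)
  qed simp
  then have "\<Phi> a = \<Phi> b" using ab by auto
  then show ?thesis by (simp add: \<Phi>_def)
qed

section \<open>Pointwise and increment bounds in terms of the derivative\<close>

lemma C1_imp_continuous:
  fixes g g1 :: "real \<Rightarrow> real"
  assumes "\<And>x. x \<in> S \<Longrightarrow> (g has_real_derivative g1 x) (at x within S)"
  shows "continuous_on S g"
  by (rule DERIV_continuous_on) (rule assms)

text \<open>The derivative \<open>2 * f * f1\<close> of the square is bounded by a weighted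
  arithmetic-geometric mean inequality, so \<open>(f x)^2\<close> exceeds \<open>(f y)^2\<close> by
  a controlled amount; averaging over \<open>y\<close> produces the term with \<open>1 / l\<close>.
  A small \<epsilon> later lets the derivative term absorb the potential and the vertex
  terms.\<close>

lemma C1_square_le:
  fixes f f1 :: "real \<Rightarrow> real"
  assumes l: "0 < l" and \<epsilon>: "0 < \<epsilon>"
    and f: "\<And>x. x \<in> {0..l} \<Longrightarrow> (f has_real_derivative f1 x) (at x within {0..l})"
    and f1: "continuous_on {0..l} f1"
    and x: "x \<in> {0..l}"
  shows "(f x)\<^sup>2 \<le> \<epsilon> * integral {0..l} (\<lambda>x. (f1 x)\<^sup>2) + (1 / \<epsilon> + 1 / l) * integral {0..l} (\<lambda>x. (f x)\<^sup>2)"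
proof -
  have cf: "continuous_on {0..l} f" using f by (rule C1_imp_continuous)
  define I where "I = integral {0..l} (\<lambda>x. (f1 x)\<^sup>2)"
  define J where "J = integral {0..l} (\<lambda>x. (f x)\<^sup>2)"
  have iI: "((\<lambda>x. (f1 x)\<^sup>2) has_integral I) {0..l}" "((\<lambda>x. (f x)\<^sup>2) has_integral J) {0..l}"
    unfolding I_def J_def
    by (intro integrable_integral integrable_continuous_real continuous_intros cf f1)+
  have hi: "((\<lambda>t. \<epsilon> * (f1 t)\<^sup>2 + (1/\<epsilon>) * (f t)\<^sup>2) has_integral \<epsilon> * I + (1/\<epsilon>) * J) {0..l}"
    by (intro has_integral_add has_integral_mult_right iI)
  have bd: "\<bar>2 * f t * f1 t\<bar> \<le> \<epsilon> * (f1 t)\<^sup>2 + (1/\<epsilon>) * (f t)\<^sup>2" for t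
  proof -
    have "0 \<le> (\<epsilon> * \<bar>f1 t\<bar> - \<bar>f t\<bar>)\<^sup>2" by simp
    then have "2 * \<epsilon> * (\<bar>f1 t\<bar> * \<bar>f t\<bar>) \<le> \<epsilon>\<^sup>2 * (f1 t)\<^sup>2 + (f t)\<^sup>2"
      by (simp add: power2_diff power_mult_distrib algebra_simps)
    then show ?thesis using \<epsilon>
      by (simp add: abs_mult field_simps power2_eq_square)
  qed
  have diff: "\<bar>(f v)\<^sup>2 - (f u)\<^sup>2\<bar> \<le> \<epsilon> * I + (1/\<epsilon>) * J" if "0 \<le> u" "u \<le> v" "v \<le> l" for u v
  proof -
    have "((\<lambda>x. (f x)\<^sup>2) has_real_derivative 2 * f x * f1 x) (at x within {0..l})" if "x \<in> {0..l}" for x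
      using f[OF that] by (auto intro!: derivative_eq_intros)
    then have h: "((\<lambda>t. 2 * f t * f1 t) has_integral (f v)\<^sup>2 - (f u)\<^sup>2) {u..v}"
      using that by (intro has_integral_C1[where a=0 and b=l]) auto
    have i': "(\<lambda>t. \<epsilon> * (f1 t)\<^sup>2 + (1/\<epsilon>) * (f t)\<^sup>2) integrable_on {u..v}"
      using that by (intro integrable_on_subinterval[OF has_integral_integrable[OF hi]]) auto
    have "norm (integral {u..v} (\<lambda>t. 2 * f t * f1 t)) \<le> integral {u..v} (\<lambda>t. \<epsilon> * (f1 t)\<^sup>2 + (1/\<epsilon>) * (f t)\<^sup>2)"
      by (rule integral_norm_bound_integral[OF has_integral_integrable[OF h] i']) (use bd in auto)
    also have "\<dots> \<le> integral {0..l} (\<lambda>t. \<epsilon> * (f1 t)\<^sup>2 + (1/\<epsilon>) * (f t)\<^sup>2)"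
      by (rule integral_subset_le[OF _ i' has_integral_integrable[OF hi]]) (use that \<epsilon> in auto)
    finally show ?thesis unfolding integral_unique[OF h] integral_unique[OF hi] by simp
  qed
  have le: "(f x)\<^sup>2 \<le> (\<epsilon> * I + (1/\<epsilon>) * J) + (f y)\<^sup>2" if "y \<in> {0..l}" for y
    using diff[of x y] diff[of y x] that x by (cases "x \<le> y") auto
  have "integral {0..l} (\<lambda>_. (f x)\<^sup>2) \<le> integral {0..l} (\<lambda>y. (\<epsilon> * I + (1/\<epsilon>) * J) + (f y)\<^sup>2)"
    by (rule integral_le[OF _ integrable_add[OF _ has_integral_integrable[OF iI(2)]]]) (use le in auto)
  also have "\<dots> = l * (\<epsilon> * I + (1/\<epsilon>) * J) + J"
    using l by (subst integral_add[OF _ has_integral_integrable[OF iI(2)]]) (auto simp: J_def)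
  finally have "(f x)\<^sup>2 * l \<le> l * (\<epsilon> * I + (1/\<epsilon>) * J) + J" using l by (simp add: mult.commute)
  then have "(f x)\<^sup>2 \<le> (l * (\<epsilon> * I + (1/\<epsilon>) * J) + J) / l"
    using l by (simp add: pos_le_divide_eq)
  also have "\<dots> = \<epsilon> * I + (1 / \<epsilon> + 1 / l) * J" using l by (simp add: field_simps)
  finally show ?thesis by (simp add: I_def J_def)
qed

text \<open>The bound of \<open>\<bar>f1 t\<bar>\<close> by
  \<open>\<delta> * (f1 t)^2 + 1 / (4 * \<delta>)\<close> replaces the Cauchy-Schwarz inequality for
  integrals. Choosing \<delta> after a bound on the derivative norms yields equicontinuity.\<close>

lemma C1_increment_le:
  fixes f f1 :: "real \<Rightarrow> real"
  assumes \<delta>: "0 < \<delta>"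
    and f: "\<And>x. x \<in> {0..l} \<Longrightarrow> (f has_real_derivative f1 x) (at x within {0..l})"
    and f1: "continuous_on {0..l} f1"
    and x: "x \<in> {0..l}" and y: "y \<in> {0..l}"
  shows "\<bar>f x - f y\<bar> \<le> \<delta> * integral {0..l} (\<lambda>x. (f1 x)\<^sup>2) + \<bar>x - y\<bar> / (4 * \<delta>)"
proof -
  have bd: "\<bar>f1 t\<bar> \<le> \<delta> * (f1 t)\<^sup>2 + 1 / (4 * \<delta>)" for t
  proof -
    have "0 \<le> (2 * \<delta> * \<bar>f1 t\<bar> - 1)\<^sup>2" by simp
    then show ?thesis using \<delta> by (simp add: power2_diff field_simps power2_eq_square)
  qed
  have i0: "(\<lambda>x. (f1 x)\<^sup>2) integrable_on {0..l}"
    by (intro integrable_continuous_real continuous_intros f1)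
  have main: "\<bar>f v - f u\<bar> \<le> \<delta> * integral {0..l} (\<lambda>x. (f1 x)\<^sup>2) + (v - u) / (4 * \<delta>)"
    if "0 \<le> u" "u \<le> v" "v \<le> l" for u v
  proof -
    have h: "(f1 has_integral f v - f u) {u..v}"
      by (rule has_integral_C1[OF f that])
    have i1: "(\<lambda>x. (f1 x)\<^sup>2) integrable_on {u..v}"
      using i0 that by (intro integrable_on_subinterval[OF i0]) auto
    have i2: "(\<lambda>t. \<delta> * (f1 t)\<^sup>2) integrable_on {u..v}"
      using integrable_on_cmult_left[OF i1, of \<delta>] by simp
    have "norm (integral {u..v} f1) \<le> integral {u..v} (\<lambda>t. \<delta> * (f1 t)\<^sup>2 + 1 / (4 * \<delta>))"
      by (rule integral_norm_bound_integral[OF has_integral_integrable[OF h]])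
        (use bd in \<open>auto intro!: integrable_add i2\<close>)
    also have "\<dots> = \<delta> * integral {u..v} (\<lambda>t. (f1 t)\<^sup>2) + (v - u) / (4 * \<delta>)"
      using i2 that by (subst integral_add) (auto simp: field_simps)
    also have "integral {u..v} (\<lambda>t. (f1 t)\<^sup>2) \<le> integral {0..l} (\<lambda>t. (f1 t)\<^sup>2)"
      by (rule integral_subset_le) (use i1 i0 that in auto)
    finally show ?thesis using \<delta> by (simp add: integral_unique[OF h])
  qed
  show ?thesis using main[of x y] main[of y x] x y by (cases "x \<le> y") auto
qed

section \<open>A second-order du Bois-Reymond argument\<close>

text \<open>The difference of \<open>w\<close> and its \<open>L^2\<close> projection onto the affine
  functions is itself one of the allowed \<open>h\<close>, so the integral of its square
  vanishes.\<close>

lemma orthogonal_to_affine_complement: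
  fixes w :: "real \<Rightarrow> real"
  assumes l: "0 < l" and w: "continuous_on {0..l} w"
    and orth: "\<And>h. continuous_on {0..l} h \<Longrightarrow> integral {0..l} h = 0 \<Longrightarrow>
      integral {0..l} (\<lambda>x. x * h x) = 0 \<Longrightarrow> integral {0..l} (\<lambda>x. w x * h x) = 0"
  obtains a b where "\<And>x. x \<in> {0..l} \<Longrightarrow> w x = a + b * x"
proof -
  define m0 where "m0 = integral {0..l} w"
  define m1 where "m1 = integral {0..l} (\<lambda>x. x * w x)"
  \<comment> \<open>The coefficients \<open>a\<close> and \<open>b\<close> solve the two moment
    equations which say that \<open>h\<close> is orthogonal to \<open>1\<close> and to
    \<open>x\<close>.\<close>
  define b where "b = 12 * (m1 - l * m0 / 2) / l^3"
  define a where "a = (m0 - b * l\<^sup>2 / 2) / l"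
  define h where "h = (\<lambda>x. w x - (a + b * x))"
  have hw: "(w has_integral m0) {0..l}" "((\<lambda>x. x * w x) has_integral m1) {0..l}"
    unfolding m0_def m1_def
    by (intro integrable_integral integrable_continuous_real continuous_intros w)+
  have hx0: "((\<lambda>x. a + b * x) has_integral (a * l + b * l\<^sup>2 / 2) - (a * 0 + b * 0\<^sup>2 / 2)) {0..l}"
    using l by (intro fundamental_theorem_of_calculus)
      (auto intro!: derivative_eq_intros simp flip: has_real_derivative_iff_has_vector_derivative)
  have hx1: "((\<lambda>x. x * (a + b * x)) has_integral (a * l\<^sup>2 / 2 + b * l^3 / 3) - (a * 0\<^sup>2 / 2 + b * 0^3 / 3)) {0..l}"
    using l by (intro fundamental_theorem_of_calculus)
      (auto intro!: derivative_eq_intros simp: power2_eq_square algebra_simps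
        simp flip: has_real_derivative_iff_has_vector_derivative)
  have ch: "continuous_on {0..l} h" unfolding h_def by (intro continuous_intros w)
  have bl: "b * l^3 = 12 * m1 - 6 * (l * m0)" using l by (simp add: b_def field_simps)
  have al: "a * l = m0 - b * l\<^sup>2 / 2" using l by (simp add: a_def)
  have z0: "(h has_integral 0) {0..l}"
    using has_integral_diff[OF hw(1) hx0] by (simp add: h_def al)
  have "a * l\<^sup>2 / 2 + b * l^3 / 3 = l * (a * l) / 2 + b * l^3 / 3"
    by (simp add: power2_eq_square algebra_simps)
  also have "\<dots> = l * m0 / 2 + b * l^3 / 12"
    unfolding al by (simp add: power2_eq_square power3_eq_cube field_simps)
  also have "\<dots> = m1" unfolding bl by (simp add: field_simps)
  finally have z1: "((\<lambda>x. x * h x) has_integral 0) {0..l}"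
    using has_integral_diff[OF hw(2) hx1] by (simp add: h_def algebra_simps)
  have "integral {0..l} (\<lambda>x. w x * h x) = 0"
    using orth[OF ch] z0 z1 by (simp add: integral_unique)
  moreover have "(\<lambda>x. w x * h x) integrable_on {0..l}"
    by (intro integrable_continuous_real continuous_intros w ch)
  ultimately have zw: "((\<lambda>x. w x * h x) has_integral 0) {0..l}"
    by (simp add: has_integral_integral)
  have "((\<lambda>x. w x * h x - (a * h x + b * (x * h x))) has_integral 0 - (a * 0 + b * 0)) {0..l}"
    by (intro has_integral_diff has_integral_add has_integral_mult_right zw z0 z1)
  then have "((\<lambda>x. h x * h x) has_integral 0) {0..l}"
    by (simp add: h_def algebra_simps)
  moreover have "continuous_on {0..l} (\<lambda>x. h x * h x)" by (intro continuous_intros ch)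
  ultimately have "\<forall>x\<in>{0..l}. h x * h x = 0"
    using integral_eq_0_iff[of 0 l "\<lambda>x. h x * h x"] l by (auto simp: integral_unique)
  then show thesis using that[of a b] by (auto simp: h_def)
qed

section \<open>Uniform limits and compactness\<close>

text \<open>The error is at most the uniform distance of \<open>F n\<close> and \<open>f\<close>
  times the integral of the absolute value of \<open>k\<close>; this is why a possibly unbounded
  weight such as \<open>q\<close> causes no trouble.\<close>

lemma tendsto_integral_mult_uniform:
  fixes k :: "real \<Rightarrow> real"
  assumes k: "k absolutely_integrable_on {a..b}"
    and u: "uniform_limit {a..b} F f sequentially"
    and c: "\<And>n. continuous_on {a..b} (F n)"
  shows "(\<lambda>n. integral {a..b} (\<lambda>x. k x * F n x)) \<longlonglongrightarrow> integral {a..b} (\<lambda>x. k x * f x)"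
proof -
  have cf: "continuous_on {a..b} f"
    by (rule uniform_limit_theorem[OF _ u]) (use c in auto)
  have kai: "(\<lambda>x. \<bar>k x\<bar>) integrable_on {a..b}" using k by (auto simp: absolutely_integrable_on_def)
  define I where "I = integral {a..b} (\<lambda>x. \<bar>k x\<bar>)"
  have I0: "0 \<le> I" unfolding I_def by (intro integral_nonneg kai) auto
  show ?thesis
  proof (rule LIMSEQ_I)
    fix r :: real assume r: "0 < r"
    \<comment> \<open>Dividing by \<open>I + 1\<close> instead of \<open>I\<close> covers the case
      \<open>I = 0\<close>.\<close>
    have "0 < r / (I + 1)" using r I0 by simp
    from uniform_limitD[OF u this] obtain N where
      N: "\<And>n x. n \<ge> N \<Longrightarrow> x \<in> {a..b} \<Longrightarrow> dist (F n x) (f x) < r / (I + 1)"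
      unfolding eventually_sequentially by blast
    have "norm (integral {a..b} (\<lambda>x. k x * F n x) - integral {a..b} (\<lambda>x. k x * f x)) < r" if "n \<ge> N" for n
    proof -
      have "integral {a..b} (\<lambda>x. k x * F n x) - integral {a..b} (\<lambda>x. k x * f x)
        = integral {a..b} (\<lambda>x. k x * (F n x - f x))"
        unfolding right_diff_distrib
        by (intro integral_diff[symmetric] integrable_mult_continuous k c cf)
      also have "norm \<dots> \<le> integral {a..b} (\<lambda>x. (r / (I + 1)) * \<bar>k x\<bar>)"
      proof (rule integral_norm_bound_integral)
        show "(\<lambda>x. k x * (F n x - f x)) integrable_on {a..b}"
          by (intro integrable_mult_continuous k continuous_intros c cf)
        fix x assume "x \<in> {a..b}"
        from N[OF that this] show "norm (k x * (F n x - f x)) \<le> r / (I + 1) * \<bar>k x\<bar>"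
          unfolding real_norm_def abs_mult by (subst mult.commute) (intro mult_right_mono, auto simp: dist_real_def)
      qed (use integrable_on_cmult_left[OF kai, of "r / (I + 1)"] in simp)
      also have "\<dots> = r * (I / (I + 1))" by (simp add: I_def)
      also have "\<dots> < r" using r I0 by (simp add: field_simps)
      finally show ?thesis .
    qed
    then show "\<exists>N. \<forall>n\<ge>N. norm (integral {a..b} (\<lambda>x. k x * F n x) - integral {a..b} (\<lambda>x. k x * f x)) < r"
      by blast
  qed
qed

text \<open>Induction over the index set: for a new index the subsequence found so far is thinned
  once more, and the uniform limits already obtained survive this.\<close>

lemma Arzela_Ascoli_finite_family:
  fixes F :: "nat \<Rightarrow> 'i \<Rightarrow> real \<Rightarrow> real"
  assumes "finite A"
    and "\<And>i. i \<in> A \<Longrightarrow> compact (S i)"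
    and "\<And>i n x. i \<in> A \<Longrightarrow> x \<in> S i \<Longrightarrow> \<bar>F n i x\<bar> \<le> M i"
    and "\<And>i x e. i \<in> A \<Longrightarrow> x \<in> S i \<Longrightarrow> 0 < e \<Longrightarrow>
      \<exists>d>0. \<forall>n. \<forall>y\<in>S i. \<bar>x - y\<bar> < d \<longrightarrow> \<bar>F n i x - F n i y\<bar> < e"
  shows "\<exists>r g. strict_mono (r :: nat \<Rightarrow> nat) \<and>
    (\<forall>i\<in>A. uniform_limit (S i) (\<lambda>n. F (r n) i) (g i) sequentially)"
  using assms
proof (induction A rule: finite_induct)
  case empty
  show ?case by (intro exI[of _ id]) (auto simp: strict_mono_def)
next
  case (insert i A)
  have "\<exists>r g. strict_mono (r :: nat \<Rightarrow> nat) \<and>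
    (\<forall>i\<in>A. uniform_limit (S i) (\<lambda>n. F (r n) i) (g i) sequentially)"
    by (rule insert.IH) (use insert.prems in \<open>simp_all\<close>)
  then obtain r g where r: "strict_mono (r :: nat \<Rightarrow> nat)"
    and g: "\<And>j. j \<in> A \<Longrightarrow> uniform_limit (S j) (\<lambda>n. F (r n) j) (g j) sequentially"
    by blast
  obtain h k where k: "strict_mono (k :: nat \<Rightarrow> nat)"
    and h: "\<And>e. 0 < e \<Longrightarrow> \<exists>N. \<forall>n x. n \<ge> N \<and> x \<in> S i \<longrightarrow> norm (F (r (k n)) i x - h x) < e"
  proof (rule Arzela_Ascoli[of "S i" "\<lambda>n. F (r n) i" "M i"])
    show "compact (S i)" using insert.prems by auto
    show "norm (F (r n) i x) \<le> M i" if "x \<in> S i" for n x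
      using insert.prems(2)[of i x "r n"] that by simp
    show "\<exists>d>0. \<forall>n y. y \<in> S i \<and> norm (x - y) < d \<longrightarrow> norm (F (r n) i x - F (r n) i y) < e"
      if "x \<in> S i" "0 < e" for x e
      using insert.prems(3)[of i x e] that unfolding real_norm_def by blast
  qed blast
  show ?case
  proof (intro exI[of _ "r \<circ> k"] exI[of _ "g(i := h)"] conjI ballI)
    show "strict_mono (r \<circ> k)" using r k by (rule strict_mono_o)
    fix j assume j: "j \<in> insert i A"
    show "uniform_limit (S j) (\<lambda>n. F ((r \<circ> k) n) j) ((g(i := h)) j) sequentially"
    proof (cases "j = i")
      case True
      then show ?thesis
        unfolding uniform_limit_iff eventually_sequentially dist_norm using h by simp blast
    next
      case False
      then have "uniform_limit (S j) (\<lambda>n. F (r n) j) (g j) sequentially" using g j by auto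
      then have "uniform_limit (S j) (\<lambda>n. F (r (k n)) j) (g j) sequentially"
        unfolding uniform_limit_iff
        using eventually_subseq[OF k] by fastforce
      then show ?thesis using False by simp
    qed
  qed
qed

section \<open>Jensen's inequality for powers and integrals of squared sines\<close>

text \<open>Young's inequality with the weights \<open>1 / p\<close> and \<open>1 - 1 / p\<close>,
  applied to \<open>x powr p\<close> and \<open>1\<close> and then multiplied by
  \<open>p\<close>.\<close>

lemma powr_ge_tangent:
  fixes x p :: real
  assumes "0 \<le> x" "1 \<le> p"
  shows "1 + p * (x - 1) \<le> x powr p"
proof (cases "x = 0")
  case False
  have "(x powr p) powr (1 / p) * 1 powr (1 - 1 / p) \<le> (1 / p) * x powr p + (1 - 1 / p) * 1"
    using assms False by (intro Youngs_inequality_0) auto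
  then have "x \<le> (1 / p) * x powr p + (1 - 1 / p)"
    using assms False by (simp add: powr_powr)
  then have "p * x \<le> p * ((1 / p) * x powr p + (1 - 1 / p))"
    using assms by (intro mult_left_mono) auto
  also have "\<dots> = x powr p + p - 1" using assms by (simp add: right_diff_distrib distrib_left)
  finally show ?thesis by (simp add: algebra_simps)
qed (use assms in auto)

text \<open>Jensen's inequality for \<open>x powr p\<close> and the probability density \<open>w / W\<close>, where the weight is
  finally estimated by \<open>w \<le> 1\<close>.\<close>

lemma weighted_mean_le_powr:
  fixes r w :: "real \<Rightarrow> real"
  assumes p: "1 \<le> p"
    and r: "r absolutely_integrable_on {a..b}" and r0: "\<And>x. 0 \<le> r x"
    and rp: "(\<lambda>x. r x powr p) integrable_on {a..b}"
    and w: "continuous_on {a..b} w" and w01: "\<And>x. 0 \<le> w x" "\<And>x. w x \<le> 1"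
    and W: "(w has_integral W) {a..b}" "0 < W"
  shows "(1 / W) * integral {a..b} (\<lambda>x. r x * w x)
    \<le> ((1 / W) * integral {a..b} (\<lambda>x. r x powr p)) powr (1 / p)"
proof -
  define c where "c = (1 / W) * integral {a..b} (\<lambda>x. r x * w x)"
  note rw = integrable_mult_continuous[OF r w]
  have rpa: "(\<lambda>x. r x powr p) absolutely_integrable_on {a..b}"
    by (rule nonnegative_absolutely_integrable_1[OF rp]) simp
  note rpw = integrable_mult_continuous[OF rpa w]
  have c0: "0 \<le> c" unfolding c_def using W r0 w01
    by (auto intro!: mult_nonneg_nonneg divide_nonneg_nonneg integral_nonneg[OF rw])
  show ?thesis
  proof (cases "c = 0")
    case True
    then show ?thesis unfolding c_def[symmetric] by simp
  next
    case False
    then have c: "0 < c" using c0 by simp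
    have iw: "integral {a..b} (\<lambda>x. r x * w x) = c * W" using W by (simp add: c_def)
    \<comment> \<open>The integrand is the tangent bound at the mean \<open>c\<close>, times the
      weight. As \<open>r\<close> has weighted mean \<open>c\<close>, the linear part integrates to
      zero and only \<open>c powr p * W\<close> remains.\<close>
    have hlow: "((\<lambda>x. c powr p * (1 - p) * w x + c powr p * p / c * (r x * w x)) has_integral
        c powr p * (1 - p) * W + c powr p * p / c * (c * W)) {a..b}"
      unfolding iw[symmetric] by (intro has_integral_add has_integral_mult_right W integrable_integral rw)
    have low: "c powr p * (1 - p) * w x + c powr p * p / c * (r x * w x) \<le> r x powr p * w x" for x
    proof -
      have "1 + p * (r x / c - 1) \<le> (r x / c) powr p"
        using r0 c p by (intro powr_ge_tangent) auto
      then have "c powr p * (1 + p * (r x / c - 1)) \<le> c powr p * (r x / c) powr p"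
        by (intro mult_left_mono) auto
      also have "c powr p * (r x / c) powr p = r x powr p"
        using c r0[of x] by (simp add: powr_divide)
      finally have "c powr p * (1 + p * (r x / c - 1)) * w x \<le> r x powr p * w x"
        using w01 by (intro mult_right_mono) auto
      then show ?thesis by (simp add: algebra_simps)
    qed
    have "c powr p * W = c powr p * (1 - p) * W + c powr p * p / c * (c * W)"
      using c by (simp add: field_simps)
    also have "\<dots> \<le> integral {a..b} (\<lambda>x. r x powr p * w x)"
      using has_integral_le[OF hlow integrable_integral[OF rpw]] low by auto
    also have "\<dots> \<le> integral {a..b} (\<lambda>x. r x powr p)"
      by (rule integral_le[OF rpw rp]) (use w01 in \<open>auto intro!: mult_left_le\<close>)
    finally have "c powr p \<le> (1 / W) * integral {a..b} (\<lambda>x. r x powr p)"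
      using W by (simp add: field_simps)
    then have "(c powr p) powr (1 / p) \<le> ((1 / W) * integral {a..b} (\<lambda>x. r x powr p)) powr (1 / p)"
      using p by (intro powr_mono2) auto
    then have "c \<le> ((1 / W) * integral {a..b} (\<lambda>x. r x powr p)) powr (1 / p)"
      using c p by (simp add: powr_powr)
    then show ?thesis unfolding c_def .
  qed
qed

lemma has_integral_sin_square:
  assumes "0 < l"
  shows "((\<lambda>x. (sin (pi * x / l))\<^sup>2) has_integral l / 2) {0..l}"
proof -
  have "((\<lambda>x. x / 2 - l / (2 * pi) * (sin (pi * x / l) * cos (pi * x / l))) has_real_derivative
      (sin (pi * x / l))\<^sup>2) (at x within {0..l})" for x
  proof -
    have lin: "((\<lambda>x. pi * x / l) has_real_derivative pi / l) (at x within {0..l})"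
      using assms by (auto intro!: derivative_eq_intros)
    have "((\<lambda>x. x / 2 - l / (2 * pi) * (sin (pi * x / l) * cos (pi * x / l))) has_real_derivative
      1 / 2 - l / (2 * pi) * (cos (pi * x / l) * (pi / l) * cos (pi * x / l)
        + - sin (pi * x / l) * (pi / l) * sin (pi * x / l))) (at x within {0..l})"
      using assms by (auto intro!: derivative_eq_intros)
    moreover have "1 / 2 - l / (2 * pi) * (cos (pi * x / l) * (pi / l) * cos (pi * x / l)
        + - sin (pi * x / l) * (pi / l) * sin (pi * x / l))
      = 1 / 2 - ((cos (pi * x / l))\<^sup>2 - (sin (pi * x / l))\<^sup>2) / 2"
    proof -
      have "l / (2 * pi) * (c * (pi / l) * c + - s * (pi / l) * s) = (c\<^sup>2 - s\<^sup>2) / 2" for c s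
        using assms by (simp add: field_simps power2_eq_square)
      then show ?thesis by simp
    qed
    ultimately show ?thesis by (simp add: cos_squared_eq field_simps)
  qed
  then have "((\<lambda>x. (sin (pi * x / l))\<^sup>2) has_integral
     (l / 2 - l / (2 * pi) * (sin (pi * l / l) * cos (pi * l / l)))
     - (0 / 2 - l / (2 * pi) * (sin (pi * 0 / l) * cos (pi * 0 / l)))) {0..l}"
    using assms by (intro fundamental_theorem_of_calculus)
      (auto simp flip: has_real_derivative_iff_has_vector_derivative)
  then show ?thesis using assms by simp
qed

lemma has_integral_cos_square:
  assumes "0 < l"
  shows "((\<lambda>x. (cos (pi * x / l))\<^sup>2) has_integral l / 2) {0..l}"
proof -
  have "((\<lambda>x. 1 - (sin (pi * x / l))\<^sup>2) has_integral l - l / 2) {0..l}"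
    using has_integral_diff[OF has_integral_const_real[of "1::real" 0 l] has_integral_sin_square[OF assms]] assms
    by simp
  then show ?thesis by (simp add: cos_squared_eq)
qed

section \<open>Discriminants, inequalities almost everywhere, absolutely continuous
  functions\<close>

text \<open>Evaluate the quadratic at its minimiser \<open>- b / c\<close>. For \<open>c = 0\<close>
  it is affine in \<open>t\<close>, and a nonzero \<open>b\<close> would let it take the value
  \<open>-1\<close>.\<close>

lemma quadratic_nonneg_imp:
  fixes a b c :: real
  assumes "\<And>t. 0 \<le> a + 2 * t * b + t\<^sup>2 * c" "0 \<le> a" "0 \<le> c"
  shows "b\<^sup>2 \<le> a * c"
proof (cases "c = 0")
  case True
  have "b = 0"
  proof (rule ccontr)
    assume b: "b \<noteq> 0"
    have "0 \<le> a + 2 * (- (a + 1) / (2 * b)) * b" using assms(1)[of "- (a + 1) / (2 * b)"] True by simp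
    also have "\<dots> = -1" using b by (simp add: field_simps)
    finally show False by simp
  qed
  then show ?thesis using True by simp
next
  case False
  then have c: "0 < c" using assms by simp
  have "0 \<le> a + 2 * (- b / c) * b + (- b / c)\<^sup>2 * c" by (rule assms)
  also have "\<dots> = a - b\<^sup>2 / c" using c by (simp add: field_simps power2_eq_square)
  finally show ?thesis using c by (simp add: field_simps)
qed

text \<open>Calculus is done with the gauge integral, but essential bounds and the differential
  equation of an eigenfunction hold only almost everywhere; the passage goes through the Lebesgue
  integral.\<close>

lemma integral_mono_AE_lebesgue_on:
  fixes f g :: "'a::euclidean_space \<Rightarrow> real"
  assumes f: "f absolutely_integrable_on S" and g: "g absolutely_integrable_on S"
    and S: "S \<in> sets lebesgue" and le: "AE x in lebesgue_on S. f x \<le> g x"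
  shows "integral S f \<le> integral S g"
proof -
  note i = absolutely_integrable_imp_integrable[OF f S] absolutely_integrable_imp_integrable[OF g S]
  from integral_mono_AE[OF i le] show ?thesis
    unfolding lebesgue_integral_eq_integral[OF i(1) S] lebesgue_integral_eq_integral[OF i(2) S] .
qed

lemma integral_cong_AE_lebesgue_on:
  fixes f g :: "'a::euclidean_space \<Rightarrow> real"
  assumes f: "f absolutely_integrable_on S" and g: "g absolutely_integrable_on S"
    and S: "S \<in> sets lebesgue" and eq: "AE x in lebesgue_on S. f x = g x"
  shows "integral S f = integral S g"
  by (intro antisym integral_mono_AE_lebesgue_on f g S) (use eq in \<open>auto elim: eventually_mono\<close>)

lemma has_ac_derivativeD:
  assumes "has_ac_derivative f g l"
  shows "g absolutely_integrable_on {0..l}"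
    and "x \<in> {0..l} \<Longrightarrow> f x = f 0 + integral {0..x} g"
  using assms unfolding has_ac_derivative_def by blast+

lemma has_ac_derivative_imp_continuous:
  assumes "has_ac_derivative f g l"
  shows "continuous_on {0..l} f"
proof -
  have "continuous_on {0..l} (\<lambda>x. f 0 + integral {0..x} g)"
    using has_ac_derivativeD(1)[OF assms] by (intro continuous_intros indefinite_integral_continuous_1)
      (auto simp: absolutely_integrable_on_def)
  then show ?thesis
    by (rule continuous_on_eq) (rule has_ac_derivativeD(2)[OF assms, symmetric])
qed

lemma has_ac_derivative_imp_has_real_derivative:
  assumes "has_ac_derivative f g l" "continuous_on {0..l} g" "x \<in> {0..l}"
  shows "(f has_real_derivative g x) (at x within {0..l})"
proof -
  have "((\<lambda>x. f 0 + integral {0..x} g) has_real_derivative g x) (at x within {0..l})"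
    using integral_has_real_derivative[OF assms(2,3)] by (auto intro!: derivative_eq_intros)
  then show ?thesis
    by (rule has_field_derivative_transform_within[OF _ zero_less_one assms(3)])
      (rule has_ac_derivativeD(2)[OF assms(1), symmetric])
qed

section \<open>Quadratic forms on a metric graph\<close>

text \<open>Double counting of edge ends: each arc is listed once under its tail and once under its
  head, a loop in both lists of the same vertex. This translates between boundary terms of
  integration by parts and vertex conditions.\<close>

lemma (in fin_digraph) sum_verts_outgoing_derivative_sum:
  "(\<Sum>v\<in>verts G. \<psi> v * outgoing_derivative_sum G len f1 v)
    = (\<Sum>e\<in>arcs G. \<psi> (tail G e) * f1 e 0 - \<psi> (head G e) * f1 e (len e))"
proof -
  have "(\<Sum>v\<in>verts G. \<psi> v * outgoing_derivative_sum G len f1 v)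
    = (\<Sum>v\<in>verts G. \<Sum>e\<in>{e\<in>arcs G. tail G e = v}. \<psi> (tail G e) * f1 e 0)
    - (\<Sum>v\<in>verts G. \<Sum>e\<in>{e\<in>arcs G. head G e = v}. \<psi> (head G e) * f1 e (len e))"
    unfolding outgoing_derivative_sum_def out_arcs_def in_arcs_def sum_subtractf[symmetric]
    by (intro sum.cong refl) (simp add: right_diff_distrib sum_distrib_left sum_negf)
  also have "(\<Sum>v\<in>verts G. \<Sum>e\<in>{e\<in>arcs G. tail G e = v}. \<psi> (tail G e) * f1 e 0)
      = (\<Sum>e\<in>arcs G. \<psi> (tail G e) * f1 e 0)"
    by (intro sum.group) auto
  also have "(\<Sum>v\<in>verts G. \<Sum>e\<in>{e\<in>arcs G. head G e = v}. \<psi> (head G e) * f1 e (len e))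
      = (\<Sum>e\<in>arcs G. \<psi> (head G e) * f1 e (len e))"
    by (intro sum.group) auto
  finally show ?thesis by (simp add: sum_subtractf)
qed

text \<open>The spectral part works with \<open>q\<close> in \<open>L^1\<close>. On edges of finite
  length this contains \<open>L^p\<close> for every \<open>p\<close> in question, so one locale
  serves all exponents.\<close>

locale schroedinger_graph = metric_graph G len
  for G :: "('v, 'e) pre_digraph" (structure) and len :: "'e \<Rightarrow> real" +
  fixes \<alpha> :: "'v \<Rightarrow> ereal" and q :: "'e \<Rightarrow> real \<Rightarrow> real"
  assumes q_integrable: "e \<in> arcs G \<Longrightarrow> q e absolutely_integrable_on {0..len e}"
begin

text \<open>The minimisation runs over functions that are \<open>C\<^sup>1\<close> on every edge rather than over \<open>W\<^sup>1\<^sup>,\<^sup>2\<close>;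
  eigenfunctions belong to this class.\<close>

definition admissible :: "('e \<Rightarrow> real \<Rightarrow> real) \<Rightarrow> ('e \<Rightarrow> real \<Rightarrow> real) \<Rightarrow> ('v \<Rightarrow> real) \<Rightarrow> bool" where
  "admissible f f1 \<phi> \<longleftrightarrow>
    (\<forall>e\<in>arcs G. (\<forall>x\<in>{0..len e}. (f e has_real_derivative f1 e x) (at x within {0..len e})) \<and>
      continuous_on {0..len e} (f1 e) \<and> f e 0 = \<phi> (tail G e) \<and> f e (len e) = \<phi> (head G e)) \<and>
    (\<forall>v\<in>verts G. \<alpha> v = \<infinity> \<longrightarrow> \<phi> v = 0)"

text \<open>Weight \<open>1\<close> gives the \<open>L^2\<close> product of functions or of
  derivatives, weight \<open>q\<close> gives the potential term.\<close>

definition edge_form ::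
  "('e \<Rightarrow> real \<Rightarrow> real) \<Rightarrow> ('e \<Rightarrow> real \<Rightarrow> real) \<Rightarrow> ('e \<Rightarrow> real \<Rightarrow> real) \<Rightarrow> real" where
  "edge_form k u v = (\<Sum>e\<in>arcs G. integral {0..len e} (\<lambda>x. k e x * (u e x * v e x)))"

text \<open>Since \<open>real_of_ereal \<infinity> = 0\<close>, Dirichlet vertices do not contribute.\<close>

definition vertex_form :: "('v \<Rightarrow> real) \<Rightarrow> ('v \<Rightarrow> real) \<Rightarrow> real" where
  "vertex_form \<phi> \<psi> = (\<Sum>v\<in>verts G. real_of_ereal (\<alpha> v) * (\<phi> v * \<psi> v))"

abbreviation l2_form :: "('e \<Rightarrow> real \<Rightarrow> real) \<Rightarrow> ('e \<Rightarrow> real \<Rightarrow> real) \<Rightarrow> real" where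
  "l2_form \<equiv> edge_form (\<lambda>_ _. 1)"

text \<open>The polarised quadratic form of \<open>H_q\<close>. Derivatives and vertex values are
  separate arguments, tied to the functions through \<open>admissible\<close>.\<close>

definition energy where
  "energy f f1 \<phi> g g1 \<psi> = l2_form f1 g1 + edge_form q f g + vertex_form \<phi> \<psi>"

section \<open>Algebra and positivity of the forms\<close>

lemma admissible_continuous:
  assumes "admissible f f1 \<phi>" "e \<in> arcs G"
  shows "continuous_on {0..len e} (f e)" "continuous_on {0..len e} (f1 e)"
  using assms by (auto simp: admissible_def intro!: C1_imp_continuous[of _ "f e" "f1 e"])

text \<open>The number \<open>t\<close> is the variable of the quadratic polynomial behind the
  Cauchy-Schwarz inequality for the form.\<close>

lemma admissible_combination:
  assumes "admissible f f1 \<phi>" "admissible g g1 \<psi>"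
  shows "admissible (\<lambda>e x. f e x + t * g e x) (\<lambda>e x. f1 e x + t * g1 e x) (\<lambda>v. \<phi> v + t * \<psi> v)"
  using assms unfolding admissible_def
  by (auto intro!: derivative_eq_intros continuous_intros)

lemma admissible_scale:
  assumes "admissible f f1 \<phi>"
  shows "admissible (\<lambda>e x. t * f e x) (\<lambda>e x. t * f1 e x) (\<lambda>v. t * \<phi> v)"
  using assms unfolding admissible_def
  by (auto intro!: derivative_eq_intros continuous_intros)

lemma edge_form_combination:
  assumes k: "\<And>e. e \<in> arcs G \<Longrightarrow> k e absolutely_integrable_on {0..len e}"
    and u: "\<And>e. e \<in> arcs G \<Longrightarrow> continuous_on {0..len e} (u e)"
    and v: "\<And>e. e \<in> arcs G \<Longrightarrow> continuous_on {0..len e} (v e)"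
  shows "edge_form k (\<lambda>e x. u e x + t * v e x) (\<lambda>e x. u e x + t * v e x)
    = edge_form k u u + 2 * t * edge_form k u v + t\<^sup>2 * edge_form k v v"
proof -
  have "integral {0..len e} (\<lambda>x. k e x * ((u e x + t * v e x) * (u e x + t * v e x)))
     = integral {0..len e} (\<lambda>x. k e x * (u e x * u e x))
       + 2 * t * integral {0..len e} (\<lambda>x. k e x * (u e x * v e x))
       + t\<^sup>2 * integral {0..len e} (\<lambda>x. k e x * (v e x * v e x))" if e: "e \<in> arcs G" for e
  proof -
    have "((\<lambda>x. k e x * (u e x * u e x) + 2 * t * (k e x * (u e x * v e x)) + t\<^sup>2 * (k e x * (v e x * v e x)))
      has_integral integral {0..len e} (\<lambda>x. k e x * (u e x * u e x))
       + 2 * t * integral {0..len e} (\<lambda>x. k e x * (u e x * v e x))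
       + t\<^sup>2 * integral {0..len e} (\<lambda>x. k e x * (v e x * v e x))) {0..len e}"
      by (intro has_integral_add has_integral_mult_right integrable_integral
        integrable_mult_continuous k e continuous_intros u v)
    from integral_unique[OF this] show ?thesis
      by (simp add: algebra_simps power2_eq_square)
  qed
  then show ?thesis
    by (simp add: edge_form_def sum.distrib sum_distrib_left)
qed

lemma one_integrable: "(\<lambda>_. 1::real) absolutely_integrable_on {0..len e}"
  by (intro absolutely_integrable_continuous_real continuous_intros)

lemma vertex_form_combination:
  "vertex_form (\<lambda>v. \<phi> v + t * \<psi> v) (\<lambda>v. \<phi> v + t * \<psi> v)
    = vertex_form \<phi> \<phi> + 2 * t * vertex_form \<phi> \<psi> + t\<^sup>2 * vertex_form \<psi> \<psi>"
  unfolding vertex_form_def sum_distrib_left sum.distrib[symmetric]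
  by (intro sum.cong) (auto simp: algebra_simps power2_eq_square)

lemma energy_combination:
  assumes "admissible f f1 \<phi>" "admissible g g1 \<psi>"
  shows "energy (\<lambda>e x. f e x + t * g e x) (\<lambda>e x. f1 e x + t * g1 e x) (\<lambda>v. \<phi> v + t * \<psi> v)
      (\<lambda>e x. f e x + t * g e x) (\<lambda>e x. f1 e x + t * g1 e x) (\<lambda>v. \<phi> v + t * \<psi> v)
    = energy f f1 \<phi> f f1 \<phi> + 2 * t * energy f f1 \<phi> g g1 \<psi> + t\<^sup>2 * energy g g1 \<psi> g g1 \<psi>"
  unfolding energy_def vertex_form_combination
  by (subst (1 2) edge_form_combination)
    (use assms in \<open>auto simp: admissible_continuous one_integrable q_integrable algebra_simps\<close>)

lemma l2_form_combination:
  assumes "admissible f f1 \<phi>" "admissible g g1 \<psi>"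
  shows "l2_form (\<lambda>e x. f e x + t * g e x) (\<lambda>e x. f e x + t * g e x)
    = l2_form f f + 2 * t * l2_form f g + t\<^sup>2 * l2_form g g"
  by (subst edge_form_combination)
    (use assms in \<open>auto simp: admissible_continuous one_integrable\<close>)

lemma edge_form_scale: "edge_form k (\<lambda>e x. t * u e x) (\<lambda>e x. t * v e x) = t\<^sup>2 * edge_form k u v"
  unfolding edge_form_def sum_distrib_left integral_mult_right[symmetric]
  by (intro sum.cong refl arg_cong[where f="integral _"]) (auto simp: algebra_simps power2_eq_square)

lemma energy_scale:
  "energy (\<lambda>e x. t * f e x) (\<lambda>e x. t * f1 e x) (\<lambda>v. t * \<phi> v)
      (\<lambda>e x. t * f e x) (\<lambda>e x. t * f1 e x) (\<lambda>v. t * \<phi> v) = t\<^sup>2 * energy f f1 \<phi> f f1 \<phi>"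
  unfolding energy_def edge_form_scale distrib_left vertex_form_def sum_distrib_left
  by (intro arg_cong2[where f="(+)"] refl sum.cong) (auto simp: algebra_simps power2_eq_square)

lemma integral_square_le_l2_form:
  assumes "\<And>e. e \<in> arcs G \<Longrightarrow> continuous_on {0..len e} (u e)" "e \<in> arcs G"
  shows "integral {0..len e} (\<lambda>x. (u e x)\<^sup>2) \<le> l2_form u u"
  unfolding edge_form_def mult_1 power2_eq_square
  by (rule member_le_sum[of e "arcs G" "\<lambda>e. integral {0..len e} (\<lambda>x. u e x * u e x)"])
    (use assms in \<open>auto intro!: integral_nonneg integrable_continuous_real continuous_intros\<close>)

lemma l2_form_nonneg:
  assumes "\<And>e. e \<in> arcs G \<Longrightarrow> continuous_on {0..len e} (u e)"
  shows "0 \<le> l2_form u u"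
  unfolding edge_form_def mult_1
  by (intro sum_nonneg integral_nonneg)
    (use assms in \<open>auto intro!: integrable_continuous_real continuous_intros\<close>)

lemma l2_form_pos:
  assumes c: "\<And>e. e \<in> arcs G \<Longrightarrow> continuous_on {0..len e} (u e)"
    and e: "e \<in> arcs G" "x \<in> {0..len e}" "u e x \<noteq> 0"
  shows "0 < l2_form u u"
proof -
  have "integral {0..len e} (\<lambda>x. (u e x)\<^sup>2) \<noteq> 0"
    using e len_pos[OF e(1)] by (subst integral_eq_0_iff) (auto intro!: continuous_intros c)
  moreover have "0 \<le> integral {0..len e} (\<lambda>x. (u e x)\<^sup>2)"
    by (intro integral_nonneg integrable_continuous_real continuous_intros c e) auto
  ultimately show ?thesis using integral_square_le_l2_form[of u e] c e by force
qed

section \<open>Coercivity of the energy\<close>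

text \<open>A common upper bound for all \<open>1 / len e\<close>, so that the estimates get
  constants independent of the edge.\<close>

definition inverse_length_sum :: real where
  "inverse_length_sum = (\<Sum>e\<in>arcs G. 1 / len e)"

lemma admissible_square_le:
  assumes f: "admissible f f1 \<phi>" and \<epsilon>: "0 < \<epsilon>" and e: "e \<in> arcs G" and x: "x \<in> {0..len e}"
  shows "(f e x)\<^sup>2 \<le> \<epsilon> * l2_form f1 f1 + (1 / \<epsilon> + inverse_length_sum) * l2_form f f"
proof -
  have le: "1 / len e \<le> inverse_length_sum"
    unfolding inverse_length_sum_def
    by (rule member_le_sum[of e "arcs G" "\<lambda>e. 1 / len e"]) (use e len_pos less_imp_le in auto)
  have "0 \<le> 1 / len e" using len_pos[OF e] by simp
  then have nonneg: "0 \<le> 1 / \<epsilon> + inverse_length_sum"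
    using le \<epsilon> order_trans by (intro add_nonneg_nonneg) (auto simp del: zero_le_divide_1_iff)
  have "(f e x)\<^sup>2 \<le> \<epsilon> * integral {0..len e} (\<lambda>x. (f1 e x)\<^sup>2)
      + (1 / \<epsilon> + 1 / len e) * integral {0..len e} (\<lambda>x. (f e x)\<^sup>2)"
    by (rule C1_square_le) (use f e x \<epsilon> len_pos in \<open>auto simp: admissible_def\<close>)
  also have "\<dots> \<le> \<epsilon> * l2_form f1 f1 + (1 / \<epsilon> + inverse_length_sum) * l2_form f f"
    using le \<epsilon> nonneg admissible_continuous[OF f] e
    by (intro add_mono mult_mono integral_square_le_l2_form integral_nonneg integrable_continuous_real
        continuous_intros) auto
  finally show ?thesis .
qed

text \<open>By the pointwise bound the potential and vertex terms amount to at most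
  \<open>T * s\<close>; \<epsilon> is so small that the derivative part of \<open>T * s\<close> uses
  up no more than half of \<open>l2_form f1 f1\<close>.\<close>

lemma energy_coercive:
  obtains C where "\<And>f f1 \<phi>. admissible f f1 \<phi> \<Longrightarrow>
    l2_form f1 f1 / 2 \<le> energy f f1 \<phi> f f1 \<phi> + C * l2_form f f"
proof -
  define T where "T = (\<Sum>e\<in>arcs G. integral {0..len e} (\<lambda>x. \<bar>q e x\<bar>)) + (\<Sum>v\<in>verts G. \<bar>real_of_ereal (\<alpha> v)\<bar>)"
  have qa: "(\<lambda>x. \<bar>q e x\<bar>) integrable_on {0..len e}" if "e \<in> arcs G" for e
    using q_integrable[OF that] by (auto simp: absolutely_integrable_on_def)
  have T0: "0 \<le> T"
    unfolding T_def by (intro add_nonneg_nonneg sum_nonneg integral_nonneg qa abs_ge_zero)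
  \<comment> \<open>The summand \<open>2\<close> keeps the denominator positive when
    \<open>T = 0\<close>.\<close>
  define \<epsilon> where "\<epsilon> = 1 / (2 * T + 2)"
  have \<epsilon>: "0 < \<epsilon>" using T0 by (simp add: \<epsilon>_def)
  have T\<epsilon>: "T * \<epsilon> \<le> 1 / 2" using T0 by (simp add: \<epsilon>_def field_simps)
  show thesis
  proof
    fix f f1 \<phi> assume f: "admissible f f1 \<phi>"
    define s where "s = \<epsilon> * l2_form f1 f1 + (1 / \<epsilon> + inverse_length_sum) * l2_form f f"
    have bd: "(f e x)\<^sup>2 \<le> s" if "e \<in> arcs G" "x \<in> {0..len e}" for e x
      unfolding s_def using admissible_square_le[OF f \<epsilon> that] .
    \<comment> \<open>Every vertex is an end point of some edge, so its value inherits the bound on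
      that edge.\<close>
    have \<phi>: "(\<phi> v)\<^sup>2 \<le> s" if v: "v \<in> verts G" for v
    proof -
      obtain e where e: "e \<in> arcs G" "tail G e = v \<or> head G e = v" using no_isolated_verts[OF v] by blast
      then show ?thesis
        using bd[OF e(1), of 0] bd[OF e(1), of "len e"] f len_pos[OF e(1)] by (auto simp: admissible_def)
    qed
    have "\<bar>edge_form q f f\<bar> \<le> (\<Sum>e\<in>arcs G. integral {0..len e} (\<lambda>x. \<bar>q e x\<bar>)) * s"
      unfolding edge_form_def sum_distrib_right
    proof (rule order_trans[OF sum_abs sum_mono])
      fix e assume e: "e \<in> arcs G"
      have "norm (integral {0..len e} (\<lambda>x. q e x * (f e x * f e x))) \<le> integral {0..len e} (\<lambda>x. \<bar>q e x\<bar> * s)"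
      proof (rule integral_norm_bound_integral)
        show "(\<lambda>x. q e x * (f e x * f e x)) integrable_on {0..len e}"
          by (intro integrable_mult_continuous q_integrable e continuous_intros admissible_continuous[OF f])
        show "(\<lambda>x. \<bar>q e x\<bar> * s) integrable_on {0..len e}"
          by (rule integrable_on_mult_left[OF qa[OF e]])
        show "norm (q e x * (f e x * f e x)) \<le> \<bar>q e x\<bar> * s" if "x \<in> {0..len e}" for x
          using bd[OF e that] by (simp add: abs_mult power2_eq_square mult_left_mono)
      qed
      then show "\<bar>integral {0..len e} (\<lambda>x. q e x * (f e x * f e x))\<bar> \<le> integral {0..len e} (\<lambda>x. \<bar>q e x\<bar>) * s"
        by simp
    qed
    moreover have "\<bar>vertex_form \<phi> \<phi>\<bar> \<le> (\<Sum>v\<in>verts G. \<bar>real_of_ereal (\<alpha> v)\<bar>) * s"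
      unfolding vertex_form_def sum_distrib_right
      by (rule order_trans[OF sum_abs sum_mono])
        (use \<phi> in \<open>simp add: abs_mult power2_eq_square mult_left_mono del: abs_real_of_ereal\<close>)
    ultimately have lower: "l2_form f1 f1 - T * s \<le> energy f f1 \<phi> f f1 \<phi>"
      unfolding energy_def T_def distrib_right by linarith
    have half: "T * \<epsilon> * l2_form f1 f1 \<le> 1 / 2 * l2_form f1 f1"
      by (intro mult_right_mono T\<epsilon> l2_form_nonneg admissible_continuous[OF f])
    show "l2_form f1 f1 / 2 \<le> energy f f1 \<phi> f f1 \<phi> + T * (1 / \<epsilon> + inverse_length_sum) * l2_form f f"
    proof -
      have "T * s = T * \<epsilon> * l2_form f1 f1 + T * (1 / \<epsilon> + inverse_length_sum) * l2_form f f"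
        by (simp add: s_def distrib_left mult.assoc)
      with lower half show ?thesis by linarith
    qed
  qed
qed

section \<open>The ground state\<close>

lemma edge_form_eq_single:
  assumes "e0 \<in> arcs G" "\<And>e x. e \<in> arcs G \<Longrightarrow> e \<noteq> e0 \<Longrightarrow> u e x * v e x = 0"
  shows "edge_form k u v = integral {0..len e0} (\<lambda>x. k e0 x * (u e0 x * v e0 x))"
proof -
  have "(\<Sum>e\<in>arcs G - {e0}. integral {0..len e} (\<lambda>x. k e x * (u e x * v e x))) = 0"
    by (intro sum.neutral ballI) (simp add: assms(2))
  then show ?thesis
    unfolding edge_form_def by (subst sum.remove[OF finite_arcs assms(1)]) simp
qed

text \<open>The Dirichlet ground state of the free operator on the edge \<open>e0\<close>, extended
  by zero. It vanishes at every vertex and hence suits arbitrary coupling strengths.\<close>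

definition sine_fun :: "'e \<Rightarrow> 'e \<Rightarrow> real \<Rightarrow> real" where
  "sine_fun e0 = (\<lambda>e x. if e = e0 then sin (pi * x / len e0) else 0)"

definition sine_fun_deriv :: "'e \<Rightarrow> 'e \<Rightarrow> real \<Rightarrow> real" where
  "sine_fun_deriv e0 = (\<lambda>e x. if e = e0 then pi / len e0 * cos (pi * x / len e0) else 0)"

lemma sine_fun_admissible:
  assumes e0: "e0 \<in> arcs G"
  shows "admissible (sine_fun e0) (sine_fun_deriv e0) (\<lambda>_. 0)"
proof -
  have "((\<lambda>x. sin (pi * x / len e0)) has_real_derivative pi / len e0 * cos (pi * x / len e0))
      (at x within {0..len e0})" for x
    using len_pos[OF e0] by (auto intro!: derivative_eq_intros)
  moreover have "continuous_on {0..len e0} (\<lambda>x. pi / len e0 * cos (pi * x / len e0))"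
    using len_pos[OF e0] by (intro continuous_intros) auto
  ultimately show ?thesis
    using len_pos[OF e0] unfolding admissible_def sine_fun_def sine_fun_deriv_def by auto
qed

lemma sine_fun_l2_form:
  assumes e0: "e0 \<in> arcs G"
  shows "l2_form (sine_fun e0) (sine_fun e0) = len e0 / 2"
    and "l2_form (sine_fun_deriv e0) (sine_fun_deriv e0) = (pi / len e0)\<^sup>2 * (len e0 / 2)"
proof -
  show "l2_form (sine_fun e0) (sine_fun e0) = len e0 / 2"
    using has_integral_sin_square[OF len_pos[OF e0]]
    by (subst edge_form_eq_single[OF e0])
      (auto simp: sine_fun_def power2_eq_square integral_unique)
  have "((\<lambda>x. (pi / len e0)\<^sup>2 * (cos (pi * x / len e0))\<^sup>2) has_integral (pi / len e0)\<^sup>2 * (len e0 / 2)) {0..len e0}"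
    by (intro has_integral_mult_right has_integral_cos_square len_pos e0)
  from integral_unique[OF this]
  show "l2_form (sine_fun_deriv e0) (sine_fun_deriv e0) = (pi / len e0)\<^sup>2 * (len e0 / 2)"
    by (subst edge_form_eq_single[OF e0])
      (auto simp: sine_fun_deriv_def power2_eq_square algebra_simps)
qed

section \<open>The infimum of the Rayleigh quotient\<close>

definition ground_energy :: real where
  "ground_energy = Inf {energy f f1 \<phi> f f1 \<phi> |f f1 \<phi>. admissible f f1 \<phi> \<and> l2_form f f = 1}"

text \<open>These facts give \<open>ground_energy\<close> its meaning, because \<open>Inf\<close> of
  real numbers is informative only for a nonempty set that is bounded below. A normalised sine
  function is the member, coercivity the lower bound.\<close>

lemma normalized_energies:
  shows "{energy f f1 \<phi> f f1 \<phi> |f f1 \<phi>. admissible f f1 \<phi> \<and> l2_form f f = 1} \<noteq> {}" (is "?S \<noteq> {}")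
    and "bdd_below {energy f f1 \<phi> f f1 \<phi> |f f1 \<phi>. admissible f f1 \<phi> \<and> l2_form f f = 1}"
proof -
  obtain e0 where e0: "e0 \<in> arcs G" using arcs_nonempty by blast
  define c where "c = sqrt (2 / len e0)"
  have "c\<^sup>2 * (len e0 / 2) = 1" using len_pos[OF e0] by (simp add: c_def)
  then have "l2_form (\<lambda>e x. c * sine_fun e0 e x) (\<lambda>e x. c * sine_fun e0 e x) = 1"
    by (simp add: edge_form_scale sine_fun_l2_form[OF e0])
  with admissible_scale[OF sine_fun_admissible[OF e0], of c] show "?S \<noteq> {}" by blast
  obtain C where C: "\<And>f f1 \<phi>. admissible f f1 \<phi> \<Longrightarrow>
      l2_form f1 f1 / 2 \<le> energy f f1 \<phi> f f1 \<phi> + C * l2_form f f"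
    using energy_coercive by blast
  show "bdd_below ?S"
  proof (rule bdd_belowI[of _ "- C"])
    fix y assume "y \<in> ?S"
    then obtain f f1 \<phi> where f: "admissible f f1 \<phi>" "l2_form f f = 1" "y = energy f f1 \<phi> f f1 \<phi>" by blast
    moreover have "0 \<le> l2_form f1 f1" using f by (intro l2_form_nonneg admissible_continuous)
    ultimately show "- C \<le> y" using C[OF f(1)] by simp
  qed
qed

text \<open>Both sides are homogeneous of degree two, so \<open>f\<close> may be normalised. If
  \<open>l2_form f f = 0\<close> this is impossible, and coercivity directly gives a nonnegative
  energy.\<close>

lemma ground_energy_le:
  assumes f: "admissible f f1 \<phi>"
  shows "ground_energy * l2_form f f \<le> energy f f1 \<phi> f f1 \<phi>"
proof (cases "l2_form f f = 0")
  case True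
  obtain C where C: "\<And>f f1 \<phi>. admissible f f1 \<phi> \<Longrightarrow>
      l2_form f1 f1 / 2 \<le> energy f f1 \<phi> f f1 \<phi> + C * l2_form f f"
    using energy_coercive by blast
  moreover have "0 \<le> l2_form f1 f1" using f by (intro l2_form_nonneg admissible_continuous)
  ultimately show ?thesis using C[OF f] True by simp
next
  case False
  moreover have "0 \<le> l2_form f f" using f by (intro l2_form_nonneg admissible_continuous)
  ultimately have pos: "0 < l2_form f f" by simp
  define c where "c = 1 / sqrt (l2_form f f)"
  have c2: "c\<^sup>2 = 1 / l2_form f f" using pos by (simp add: c_def power_divide)
  have "l2_form (\<lambda>e x. c * f e x) (\<lambda>e x. c * f e x) = 1"
    using pos by (simp add: edge_form_scale c2)
  then have "ground_energy \<le> c\<^sup>2 * energy f f1 \<phi> f f1 \<phi>"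
    unfolding ground_energy_def energy_scale[symmetric]
    using admissible_scale[OF f] by (intro cInf_lower normalized_energies) blast
  then show ?thesis using pos by (simp add: c2 field_simps)
qed

text \<open>Along the line \<open>f + t * g\<close> the energy minus \<open>ground_energy\<close>
  times the squared norm is a nonnegative quadratic polynomial in \<open>t\<close>.\<close>

lemma energy_Cauchy_Schwarz:
  assumes f: "admissible f f1 \<phi>" and g: "admissible g g1 \<psi>"
  shows "(energy f f1 \<phi> g g1 \<psi> - ground_energy * l2_form f g)\<^sup>2
    \<le> (energy f f1 \<phi> f f1 \<phi> - ground_energy * l2_form f f)
      * (energy g g1 \<psi> g g1 \<psi> - ground_energy * l2_form g g)"
proof (rule quadratic_nonneg_imp)
  fix t
  show "0 \<le> (energy f f1 \<phi> f f1 \<phi> - ground_energy * l2_form f f)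
      + 2 * t * (energy f f1 \<phi> g g1 \<psi> - ground_energy * l2_form f g)
      + t\<^sup>2 * (energy g g1 \<psi> g g1 \<psi> - ground_energy * l2_form g g)"
    using ground_energy_le[OF admissible_combination[OF f g, of t]]
    unfolding energy_combination[OF f g] l2_form_combination[OF f g]
    by (simp add: algebra_simps)
qed (use ground_energy_le[OF f] ground_energy_le[OF g] in auto)

text \<open>Both integrations by parts are already carried out, so no derivative of \<open>f\<close> occurs.\<close>

definition weak_solution :: "real \<Rightarrow> ('e \<Rightarrow> real \<Rightarrow> real) \<Rightarrow> ('v \<Rightarrow> real) \<Rightarrow> bool" where
  "weak_solution \<mu> f \<phi> \<longleftrightarrow>
    (\<forall>e\<in>arcs G. continuous_on {0..len e} (f e) \<and> f e 0 = \<phi> (tail G e) \<and> f e (len e) = \<phi> (head G e)) \<and>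
    (\<forall>v\<in>verts G. \<alpha> v = \<infinity> \<longrightarrow> \<phi> v = 0) \<and>
    (\<forall>g g1 g2 \<psi>. admissible g g1 \<psi> \<longrightarrow>
      (\<forall>e\<in>arcs G. (\<forall>x\<in>{0..len e}. (g1 e has_real_derivative g2 e x) (at x within {0..len e})) \<and>
        continuous_on {0..len e} (g2 e)) \<longrightarrow>
      (\<Sum>e\<in>arcs G. f e (len e) * g1 e (len e) - f e 0 * g1 e 0 - integral {0..len e} (\<lambda>x. f e x * g2 e x))
        + edge_form q f g + vertex_form \<phi> \<psi> = \<mu> * l2_form f g)"

section \<open>Limits of the forms and existence of a ground state\<close>

text \<open>The fixed continuous factor \<open>g\<close> is absorbed into the weight, which leaves a
  single varying function.\<close>

lemma edge_form_tendsto: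
  assumes k: "\<And>e. e \<in> arcs G \<Longrightarrow> k e absolutely_integrable_on {0..len e}"
    and g: "\<And>e. e \<in> arcs G \<Longrightarrow> continuous_on {0..len e} (g e)"
    and F: "\<And>n e. e \<in> arcs G \<Longrightarrow> continuous_on {0..len e} (F n e)"
    and lim: "\<And>e. e \<in> arcs G \<Longrightarrow> uniform_limit {0..len e} (\<lambda>n. F n e) (f e) sequentially"
  shows "(\<lambda>n. edge_form k (F n) g) \<longlonglongrightarrow> edge_form k f g"
proof -
  have "(\<lambda>n. edge_form (\<lambda>e x. k e x * g e x) (F n) (\<lambda>_ _. 1)) \<longlonglongrightarrow> edge_form (\<lambda>e x. k e x * g e x) f (\<lambda>_ _. 1)"
    unfolding edge_form_def mult_1_right
    by (intro tendsto_sum tendsto_integral_mult_uniform absolutely_integrable_mult_continuous k g F lim)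
  then show ?thesis by (simp add: edge_form_def mult_ac)
qed

text \<open>Here both factors vary. Products of uniform limits converge uniformly because the limit,
  being continuous on a compact edge, is bounded.\<close>

lemma l2_form_tendsto:
  assumes F: "\<And>n e. e \<in> arcs G \<Longrightarrow> continuous_on {0..len e} (F n e)"
    and lim: "\<And>e. e \<in> arcs G \<Longrightarrow> uniform_limit {0..len e} (\<lambda>n. F n e) (f e) sequentially"
  shows "(\<lambda>n. l2_form (F n) (F n)) \<longlonglongrightarrow> l2_form f f"
  unfolding edge_form_def
proof (intro tendsto_sum tendsto_integral_mult_uniform one_integrable continuous_intros F)
  fix e assume e: "e \<in> arcs G"
  have "continuous_on {0..len e} (f e)"
    by (rule uniform_limit_theorem[OF _ lim[OF e]]) (use F e in auto)
  then have "bounded (f e ` {0..len e})"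
    by (intro compact_imp_bounded compact_continuous_image) auto
  then show "uniform_limit {0..len e} (\<lambda>n x. F n e x * F n e x) (\<lambda>x. f e x * f e x) sequentially"
    by (intro uniform_lim_mult lim e)
qed

lemma ground_state_exists:
  obtains f \<phi> where "weak_solution ground_energy f \<phi>" "l2_form f f = 1"
proof -
  obtain C where C: "\<And>f f1 \<phi>. admissible f f1 \<phi> \<Longrightarrow>
      l2_form f1 f1 / 2 \<le> energy f f1 \<phi> f f1 \<phi> + C * l2_form f f"
    using energy_coercive by blast
  have "\<exists>f f1 \<phi>. admissible f f1 \<phi> \<and> l2_form f f = 1
      \<and> energy f f1 \<phi> f f1 \<phi> < ground_energy + inverse (real (Suc n))" for n
    using cInf_lessD[OF normalized_energies(1), of "ground_energy + inverse (real (Suc n))"]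
    unfolding ground_energy_def[symmetric] by force
  then obtain F F1 \<Phi> where adm: "\<And>n. admissible (F n) (F1 n) (\<Phi> n)"
    and norm1: "\<And>n. l2_form (F n) (F n) = 1"
    and en: "\<And>n. energy (F n) (F1 n) (\<Phi> n) (F n) (F1 n) (\<Phi> n) < ground_energy + inverse (real (Suc n))"
    by metis
  \<comment> \<open>Coercivity for functions of norm one and energy at most
    \<open>ground_energy + 1\<close> bounds the derivative norms by this constant.\<close>
  define B where "B = 2 * (ground_energy + 1 + C)"
  have E0: "0 \<le> l2_form (F1 n) (F1 n)" for n
    by (intro l2_form_nonneg admissible_continuous[OF adm])
  have EB: "l2_form (F1 n) (F1 n) \<le> B" for n
  proof -
    have "inverse (real (Suc n)) \<le> 1" by (simp add: field_simps)
    then show ?thesis using C[OF adm[of n]] norm1[of n] en[of n] by (simp add: B_def)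
  qed
  have B0: "0 \<le> B" using E0 EB order_trans by blast
  have cont: "continuous_on {0..len e} (F n e)" "continuous_on {0..len e} (F1 n e)" if "e \<in> arcs G" for n e
    using admissible_continuous[OF adm that] by auto
  have "\<exists>r f. strict_mono (r :: nat \<Rightarrow> nat) \<and>
    (\<forall>e\<in>arcs G. uniform_limit {0..len e} (\<lambda>n. F (r n) e) (f e) sequentially)"
  proof (rule Arzela_Ascoli_finite_family)
    fix e n x assume e: "e \<in> arcs G" "x \<in> {0..len e}"
    have "(F n e x)\<^sup>2 \<le> B + (1 + inverse_length_sum)"
      using admissible_square_le[OF adm[of n], of 1 e x] e EB[of n] norm1[of n] by simp
    from real_sqrt_le_mono[OF this] show "\<bar>F n e x\<bar> \<le> sqrt (B + (1 + inverse_length_sum))"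
      by simp
  next
    fix e x and \<eta> :: real assume e: "e \<in> arcs G" "x \<in> {0..len e}" and \<eta>: "0 < \<eta>"
    \<comment> \<open>Then \<open>\<delta> * B\<close> is at most \<open>\<eta> / 2\<close>, and
      distances below \<open>2 * \<delta> * \<eta>\<close> make the second term of the increment
      bound less than \<open>\<eta> / 2\<close>. The summand \<open>1\<close> covers
      \<open>B = 0\<close>.\<close>
    define \<delta> where "\<delta> = \<eta> / (2 * (B + 1))"
    have \<delta>: "0 < \<delta>" using \<eta> B0 by (simp add: \<delta>_def)
    show "\<exists>d>0. \<forall>n. \<forall>y\<in>{0..len e}. \<bar>x - y\<bar> < d \<longrightarrow> \<bar>F n e x - F n e y\<bar> < \<eta>"
    proof (intro exI[of _ "2 * \<delta> * \<eta>"] conjI allI ballI impI)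
      show "0 < 2 * \<delta> * \<eta>" using \<delta> \<eta> by simp
      fix n y assume y: "y \<in> {0..len e}" "\<bar>x - y\<bar> < 2 * \<delta> * \<eta>"
      have "\<bar>F n e x - F n e y\<bar> \<le> \<delta> * integral {0..len e} (\<lambda>x. (F1 n e x)\<^sup>2) + \<bar>x - y\<bar> / (4 * \<delta>)"
        by (rule C1_increment_le[OF \<delta>]) (use adm[of n] e y in \<open>auto simp: admissible_def\<close>)
      also have "\<delta> * integral {0..len e} (\<lambda>x. (F1 n e x)\<^sup>2) \<le> \<delta> * B"
        using \<delta> integral_square_le_l2_form[of "F1 n" e] cont e EB[of n]
        by (intro mult_left_mono) (auto intro: order_trans)
      also have "\<delta> * B \<le> \<eta> / 2" using B0 \<eta> by (simp add: \<delta>_def field_simps)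
      also have "\<bar>x - y\<bar> / (4 * \<delta>) < \<eta> / 2" using y \<delta> by (simp add: field_simps)
      finally show "\<bar>F n e x - F n e y\<bar> < \<eta>" by simp
    qed
  qed auto
  then obtain r :: "nat \<Rightarrow> nat" and f where r: "strict_mono r"
    and lim: "\<And>e. e \<in> arcs G \<Longrightarrow> uniform_limit {0..len e} (\<lambda>n. F (r n) e) (f e) sequentially"
    by blast
  \<comment> \<open>At a vertex this limit exists because the vertex is an end point of an edge on
    which the subsequence converges uniformly.\<close>
  define \<phi> where "\<phi> v = lim (\<lambda>n. \<Phi> (r n) v)" for v
  have lim0: "(\<lambda>n. F (r n) e 0) \<longlonglongrightarrow> f e 0" and liml: "(\<lambda>n. F (r n) e (len e)) \<longlonglongrightarrow> f e (len e)"
    if "e \<in> arcs G" for e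
    using len_pos[OF that] by (auto intro!: tendsto_uniform_limitI[OF lim[OF that]])
  have ends: "F n e 0 = \<Phi> n (tail G e)" "F n e (len e) = \<Phi> n (head G e)" if "e \<in> arcs G" for n e
    using adm[of n] that by (auto simp: admissible_def)
  have fends: "f e 0 = \<phi> (tail G e)" "f e (len e) = \<phi> (head G e)" if "e \<in> arcs G" for e
    using limI[OF lim0[OF that]] limI[OF liml[OF that]] by (auto simp: \<phi>_def ends[OF that])
  have limv: "(\<lambda>n. \<Phi> (r n) v) \<longlonglongrightarrow> \<phi> v" if v: "v \<in> verts G" for v
  proof -
    obtain e where e: "e \<in> arcs G" "tail G e = v \<or> head G e = v" using no_isolated_verts[OF v] by blast
    then show ?thesis
      using lim0[OF e(1)] liml[OF e(1)] by (auto simp: ends[OF e(1)] fends[OF e(1)])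
  qed
  have contf: "continuous_on {0..len e} (f e)" if "e \<in> arcs G" for e
    by (rule uniform_limit_theorem[OF _ lim[OF that]]) (use cont that in auto)
  have "(\<lambda>n. l2_form (F (r n)) (F (r n))) \<longlonglongrightarrow> l2_form f f"
    by (intro l2_form_tendsto cont lim)
  then have "l2_form f f = 1" by (simp add: norm1 LIMSEQ_const_iff)
  moreover have "weak_solution ground_energy f \<phi>"
    unfolding weak_solution_def
  proof (intro conjI ballI impI allI)
    fix v assume v: "v \<in> verts G" "\<alpha> v = \<infinity>"
    have "\<Phi> n v = 0" for n using adm[of n] v by (auto simp: admissible_def)
    then show "\<phi> v = 0" by (simp add: \<phi>_def)
  next
    fix g g1 g2 \<psi> assume g: "admissible g g1 \<psi>"
      and g2: "\<forall>e\<in>arcs G. (\<forall>x\<in>{0..len e}. (g1 e has_real_derivative g2 e x) (at x within {0..len e})) \<and>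
        continuous_on {0..len e} (g2 e)"
    let ?b = "\<lambda>f. \<Sum>e\<in>arcs G. f e (len e) * g1 e (len e) - f e 0 * g1 e 0 - integral {0..len e} (\<lambda>x. f e x * g2 e x)"
    \<comment> \<open>The product with \<open>g\<close> in the form shifted by
      \<open>ground_energy\<close>. It tends to zero because the first factor in the Cauchy-Schwarz
      bound is the excess energy of the minimising sequence.\<close>
    define D where "D n = energy (F (r n)) (F1 (r n)) (\<Phi> (r n)) g g1 \<psi> - ground_energy * l2_form (F (r n)) g" for n
    define c where "c = energy g g1 \<psi> g g1 \<psi> - ground_energy * l2_form g g"
    have c0: "0 \<le> c" using ground_energy_le[OF g] by (simp add: c_def)
    have D2: "(D n)\<^sup>2 \<le> inverse (real (Suc n)) * c" for n
    proof -
      have "(D n)\<^sup>2 \<le> (energy (F (r n)) (F1 (r n)) (\<Phi> (r n)) (F (r n)) (F1 (r n)) (\<Phi> (r n))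
          - ground_energy * l2_form (F (r n)) (F (r n))) * c"
        unfolding D_def c_def by (rule energy_Cauchy_Schwarz[OF adm g])
      also have "\<dots> \<le> inverse (real (Suc (r n))) * c"
        using en[of "r n"] c0 by (intro mult_right_mono) (simp_all add: norm1)
      also have "\<dots> \<le> inverse (real (Suc n)) * c"
        using seq_suble[OF r, of n] c0 by (intro mult_right_mono le_imp_inverse_le) auto
      finally show ?thesis .
    qed
    have "(\<lambda>n. (D n)\<^sup>2) \<longlonglongrightarrow> 0"
    proof (rule tendsto_sandwich[OF _ _ tendsto_const])
      show "(\<lambda>n. inverse (real (Suc n)) * c) \<longlonglongrightarrow> 0"
        using tendsto_mult_right[OF LIMSEQ_inverse_real_of_nat, of c] by simp
    qed (use D2 in auto)
    from tendsto_real_sqrt[OF this] have "(\<lambda>n. \<bar>D n\<bar>) \<longlonglongrightarrow> 0" by simp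
    then have Dlim0: "D \<longlonglongrightarrow> 0" by (simp add: tendsto_rabs_zero_iff)
    \<comment> \<open>The derivatives \<open>F1 n\<close> are only known to be bounded in norm. On
      the right side just the values of \<open>F n\<close> occur, and these converge.\<close>
    have parts: "l2_form (F1 n) g1 = ?b (F n)" for n
      unfolding edge_form_def mult_1
    proof (intro sum.cong refl integration_by_parts_ac)
      fix e x assume e: "e \<in> arcs G" and x: "x \<in> {0..len e}"
      have "(F1 n e has_integral F n e x - F n e 0) {0..x}"
        by (rule has_integral_C1[where a=0 and b="len e"]) (use adm[of n] e x in \<open>auto simp: admissible_def\<close>)
      then show "F n e x = F n e 0 + integral {0..x} (F1 n e)" by (simp add: integral_unique)
    qed (use g2 len_pos in \<open>auto intro!: absolutely_integrable_continuous_real cont simp: less_imp_le\<close>)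
    have inner: "(\<lambda>n. edge_form (\<lambda>_ _. 1) (F (r n)) g2) \<longlonglongrightarrow> l2_form f g2"
      by (intro edge_form_tendsto one_integrable cont lim) (use g2 in auto)
    have boundary: "(\<lambda>n. \<Sum>e\<in>arcs G. F (r n) e (len e) * g1 e (len e) - F (r n) e 0 * g1 e 0)
        \<longlonglongrightarrow> (\<Sum>e\<in>arcs G. f e (len e) * g1 e (len e) - f e 0 * g1 e 0)"
      by (intro tendsto_diff tendsto_sum tendsto_mult tendsto_const lim0 liml)
    have b_lim: "(\<lambda>n. ?b (F (r n))) \<longlonglongrightarrow> ?b f"
      using tendsto_diff[OF boundary inner[unfolded edge_form_def mult_1]] by (simp only: sum_subtractf)
    have q_lim: "(\<lambda>n. edge_form q (F (r n)) g) \<longlonglongrightarrow> edge_form q f g"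
      by (intro edge_form_tendsto q_integrable cont lim admissible_continuous[OF g])
    have l2_lim: "(\<lambda>n. l2_form (F (r n)) g) \<longlonglongrightarrow> l2_form f g"
      by (intro edge_form_tendsto one_integrable cont lim admissible_continuous[OF g])
    have v_lim: "(\<lambda>n. vertex_form (\<Phi> (r n)) \<psi>) \<longlonglongrightarrow> vertex_form \<phi> \<psi>"
      unfolding vertex_form_def by (intro tendsto_sum tendsto_mult tendsto_const limv)
    have Dlim: "D \<longlonglongrightarrow> ?b f + edge_form q f g + vertex_form \<phi> \<psi> - ground_energy * l2_form f g"
      unfolding D_def energy_def parts 
      by (rule tendsto_diff[OF tendsto_add[OF tendsto_add[OF b_lim q_lim] v_lim] tendsto_mult_left[OF l2_lim]])
    from LIMSEQ_unique[OF Dlim Dlim0]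
    show "?b f + edge_form q f g + vertex_form \<phi> \<psi> = ground_energy * l2_form f g" by simp
  qed (use contf fends in auto)
  ultimately show thesis using that by blast
qed

section \<open>Regularity of weak solutions\<close>

lemma potential_integrable:
  assumes "e \<in> arcs G" "continuous_on {0..len e} f"
  shows "(\<lambda>x. (q e x - \<mu>) * f x) absolutely_integrable_on {0..len e}"
  by (intro absolutely_integrable_mult_continuous assms set_integral_diff q_integrable
      absolutely_integrable_continuous_real continuous_intros)

lemma integral_potential:
  assumes "e \<in> arcs G" "continuous_on {0..len e} f" "continuous_on {0..len e} g"
  shows "integral {0..len e} (\<lambda>x. (q e x - \<mu>) * f x * g x)
    = integral {0..len e} (\<lambda>x. q e x * (f x * g x)) - \<mu> * integral {0..len e} (\<lambda>x. f x * g x)"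
proof -
  have "((\<lambda>x. q e x * (f x * g x) - \<mu> * (f x * g x)) has_integral
      integral {0..len e} (\<lambda>x. q e x * (f x * g x)) - \<mu> * integral {0..len e} (\<lambda>x. f x * g x)) {0..len e}"
    by (intro has_integral_diff has_integral_mult_right integrable_integral integrable_mult_continuous
        integrable_continuous_real q_integrable continuous_intros assms)
  from integral_unique[OF this] show ?thesis by (simp add: algebra_simps)
qed

lemma edge_form_potential:
  assumes "\<And>e. e \<in> arcs G \<Longrightarrow> continuous_on {0..len e} (f e)"
    and "\<And>e. e \<in> arcs G \<Longrightarrow> continuous_on {0..len e} (g e)"
  shows "(\<Sum>e\<in>arcs G. integral {0..len e} (\<lambda>x. (q e x - \<mu>) * f e x * g e x))
    = edge_form q f g - \<mu> * l2_form f g"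
  using assms by (simp add: integral_potential edge_form_def sum_subtractf sum_distrib_left)

lemma weak_solutionD:
  assumes "weak_solution \<mu> f \<phi>" "admissible g g1 \<psi>"
    and "\<And>e x. e \<in> arcs G \<Longrightarrow> x \<in> {0..len e} \<Longrightarrow>
      (g1 e has_real_derivative g2 e x) (at x within {0..len e})"
    and "\<And>e. e \<in> arcs G \<Longrightarrow> continuous_on {0..len e} (g2 e)"
  shows "(\<Sum>e\<in>arcs G. f e (len e) * g1 e (len e) - f e 0 * g1 e 0 - integral {0..len e} (\<lambda>x. f e x * g2 e x))
      + edge_form q f g + vertex_form \<phi> \<psi> = \<mu> * l2_form f g"
  by (rule assms(1)[unfolded weak_solution_def, THEN conjunct2, THEN conjunct2, rule_format, OF assms(2)])
    (use assms(3,4) in auto)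

text \<open>Test functions living on \<open>e0\<close> that vanish there with their derivative at
  both ends produce neither boundary nor vertex terms. Against their second derivatives
  \<open>h\<close>, the function \<open>f\<close> acts like the second antiderivative of
  \<open>(q - \<mu>) f\<close>, so the two differ by an affine function.\<close>

lemma weak_solution_regular:
  assumes wf: "weak_solution \<mu> f \<phi>" and e0: "e0 \<in> arcs G"
  shows "\<exists>f1. has_ac_derivative (f e0) f1 (len e0) \<and>
    has_ac_derivative f1 (\<lambda>x. (q e0 x - \<mu>) * f e0 x) (len e0)"
proof -
  define l where "l = len e0"
  have l: "0 < l" unfolding l_def by (rule len_pos[OF e0])
  have cf: "continuous_on {0..len e} (f e)" if "e \<in> arcs G" for e
    using wf that by (auto simp: weak_solution_def)
  \<comment> \<open>The second derivative that \<open>f\<close> has to have; \<open>K\<close> and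
    \<open>F\<close> are its first and second antiderivatives.\<close>
  define k where "k = (\<lambda>x. (q e0 x - \<mu>) * f e0 x)"
  have k: "k absolutely_integrable_on {0..l}"
    unfolding k_def l_def by (intro potential_integrable e0 cf)
  define K where "K = (\<lambda>x. integral {0..x} k)"
  have cK: "continuous_on {0..l} K"
    unfolding K_def using k by (intro indefinite_integral_continuous_1) (auto simp: absolutely_integrable_on_def)
  define F where "F = (\<lambda>x. integral {0..x} K)"
  have cF: "continuous_on {0..l} F"
    unfolding F_def by (intro indefinite_integral_continuous_1 integrable_continuous_real cK)
  have ends0: "K 0 = 0" "F 0 = 0" by (auto simp: K_def F_def)
  have orth: "integral {0..l} (\<lambda>x. (f e0 x - F x) * h x) = 0"
    if h: "continuous_on {0..l} h" "integral {0..l} h = 0" "integral {0..l} (\<lambda>x. x * h x) = 0" for h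
  proof -
    \<comment> \<open>The test function is \<open>h2\<close>, with second derivative
      \<open>h\<close>. The two moment conditions on \<open>h\<close> amount to
      \<open>h1 l = 0\<close> and \<open>h2 l = 0\<close>.\<close>
    define h1 where "h1 = (\<lambda>x. integral {0..x} h)"
    define h2 where "h2 = (\<lambda>x. integral {0..x} h1)"
    have d1: "(h1 has_real_derivative h x) (at x within {0..l})" if "x \<in> {0..l}" for x
      unfolding h1_def by (rule integral_has_real_derivative[OF h(1) that])
    have ch1: "continuous_on {0..l} h1" by (rule C1_imp_continuous[OF d1])
    have d2: "(h2 has_real_derivative h1 x) (at x within {0..l})" if "x \<in> {0..l}" for x
      unfolding h2_def by (rule integral_has_real_derivative[OF ch1 that])
    have ch2: "continuous_on {0..l} h2" by (rule C1_imp_continuous[OF d2])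
    have h1_ends: "h1 0 = 0" "h1 l = 0" "h2 0 = 0" using h by (auto simp: h1_def h2_def)
    \<comment> \<open>Once \<open>h1 l = 0\<close> is known, the right side is
      \<open>- h2 l\<close>.\<close>
    have "integral {0..l} (\<lambda>x. h x * x) = h1 l * l - h1 0 * 0 - integral {0..l} (\<lambda>x. h1 x * 1)"
      by (rule integration_by_parts_ac)
        (use l h in \<open>auto intro!: absolutely_integrable_continuous_real derivative_eq_intros simp: h1_def\<close>)
    then have h2l: "h2 l = 0" using h(3) by (simp add: h1_ends h2_def mult.commute)
    define g where "g = (\<lambda>e x. if e = e0 then h2 x else 0)"
    define g1 where "g1 = (\<lambda>e x. if e = e0 then h1 x else 0)"
    define g2 where "g2 = (\<lambda>e x. if e = e0 then h x else 0)"
    have g: "admissible g g1 (\<lambda>_. 0)"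
      using d2 ch1 h1_ends h2l e0 unfolding admissible_def g_def g1_def l_def by auto
    have "(\<Sum>e\<in>arcs G. f e (len e) * g1 e (len e) - f e 0 * g1 e 0 - integral {0..len e} (\<lambda>x. f e x * g2 e x))
        + edge_form q f g + vertex_form \<phi> (\<lambda>_. 0) = \<mu> * l2_form f g"
    proof (rule weak_solutionD[OF wf g])
      fix e assume "e \<in> arcs G"
      show "continuous_on {0..len e} (g2 e)"
        using h(1) by (cases "e = e0") (auto simp: g2_def l_def)
      show "(g1 e has_real_derivative g2 e x) (at x within {0..len e})" if "x \<in> {0..len e}" for x
        using d1 that by (cases "e = e0") (auto simp: g1_def g2_def l_def)
    qed
    moreover have "(\<Sum>e\<in>arcs G. f e (len e) * g1 e (len e) - f e 0 * g1 e 0 - integral {0..len e} (\<lambda>x. f e x * g2 e x))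
        = - integral {0..l} (\<lambda>x. f e0 x * h x)"
    proof -
      have "(\<Sum>e\<in>arcs G - {e0}. f e (len e) * g1 e (len e) - f e 0 * g1 e 0 - integral {0..len e} (\<lambda>x. f e x * g2 e x)) = 0"
        by (intro sum.neutral ballI) (simp add: g1_def g2_def)
      then show ?thesis
        using h1_ends by (subst sum.remove[OF finite_arcs e0]) (simp add: g1_def g2_def l_def)
    qed
    moreover have "vertex_form \<phi> (\<lambda>_. 0) = 0" by (simp add: vertex_form_def)
    moreover have "edge_form q f g = integral {0..l} (\<lambda>x. q e0 x * (f e0 x * h2 x))"
      by (subst edge_form_eq_single[OF e0]) (auto simp: g_def l_def)
    moreover have "l2_form f g = integral {0..l} (\<lambda>x. f e0 x * h2 x)"
      by (subst edge_form_eq_single[OF e0]) (auto simp: g_def l_def)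
    moreover have "integral {0..l} (\<lambda>x. k x * h2 x)
        = integral {0..l} (\<lambda>x. q e0 x * (f e0 x * h2 x)) - \<mu> * integral {0..l} (\<lambda>x. f e0 x * h2 x)"
      unfolding k_def l_def by (intro integral_potential e0 cf ch2[unfolded l_def])
    \<comment> \<open>Two integrations by parts carry \<open>k\<close> to \<open>F\<close> and
      \<open>h2\<close> to \<open>h\<close>; all end point terms vanish and the two signs
      cancel.\<close>
    moreover have "integral {0..l} (\<lambda>x. k x * h2 x) = K l * h2 l - K 0 * h2 0 - integral {0..l} (\<lambda>x. K x * h1 x)"
      by (rule integration_by_parts_ac) (use l k d2 ch1 in \<open>auto simp: K_def\<close>)
    moreover have "integral {0..l} (\<lambda>x. K x * h1 x) = F l * h1 l - F 0 * h1 0 - integral {0..l} (\<lambda>x. F x * h x)"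
      by (rule integration_by_parts_ac)
        (use l d1 h(1) in \<open>auto simp: F_def intro!: absolutely_integrable_continuous_real cK\<close>)
    ultimately have "integral {0..l} (\<lambda>x. f e0 x * h x) = integral {0..l} (\<lambda>x. F x * h x)"
      by (simp add: h1_ends h2l)
    moreover have "integral {0..l} (\<lambda>x. (f e0 x - F x) * h x)
        = integral {0..l} (\<lambda>x. f e0 x * h x) - integral {0..l} (\<lambda>x. F x * h x)"
      unfolding left_diff_distrib
      by (intro integral_diff integrable_continuous_real continuous_intros cF h(1) cf[OF e0, folded l_def])
    ultimately show ?thesis by simp
  qed
  have "continuous_on {0..l} (\<lambda>x. f e0 x - F x)"
    by (intro continuous_intros cF cf[OF e0, folded l_def])
  from orthogonal_to_affine_complement[OF l this orth] obtain a b
    where ab: "\<And>x. x \<in> {0..l} \<Longrightarrow> f e0 x - F x = a + b * x" by blast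
  \<comment> \<open>The slope \<open>b\<close> of the affine difference is the constant of
    integration in the first derivative.\<close>
  have "has_ac_derivative (f e0) (\<lambda>x. K x + b) l"
    unfolding has_ac_derivative_def
  proof (intro conjI ballI)
    show "(\<lambda>x. K x + b) absolutely_integrable_on {0..l}"
      by (intro absolutely_integrable_continuous_real continuous_intros cK)
    fix x assume x: "x \<in> {0..l}"
    have "continuous_on {0..x} K" using cK x by (auto intro: continuous_on_subset)
    then have "integral {0..x} (\<lambda>x. K x + b) = F x + b * x"
      unfolding F_def using x by (subst integral_add) (auto intro!: integrable_continuous_real)
    then show "f e0 x = f e0 0 + integral {0..x} (\<lambda>x. K x + b)"
      using ab[OF x] ab[of 0] l ends0 by simp
  qed
  moreover have "has_ac_derivative (\<lambda>x. K x + b) k l"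
    unfolding has_ac_derivative_def using k ends0 by (auto simp: K_def)
  ultimately show ?thesis unfolding k_def l_def by blast
qed

section \<open>Weak solutions and eigenfunctions\<close>

text \<open>The equation on the edges is regularity. For the condition at a non-Dirichlet vertex the
  test function is the edgewise affine one with value \<open>1\<close> there and \<open>0\<close> at
  the other vertices; its second derivative vanishes, so one integration by parts isolates the
  outgoing derivatives.\<close>

lemma weak_solution_imp_schroedinger:
  assumes wf: "weak_solution \<mu> f \<phi>"
  shows "schroedinger G len \<alpha> q f (\<lambda>e x. \<mu> * f e x)"
proof -
  have cf: "continuous_on {0..len e} (f e)" and ends: "f e 0 = \<phi> (tail G e)" "f e (len e) = \<phi> (head G e)"
    if "e \<in> arcs G" for e
    using wf that by (auto simp: weak_solution_def)
  define f2 where "f2 = (\<lambda>e x. (q e x - \<mu>) * f e x)"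
  obtain f1 where f1: "\<And>e. e \<in> arcs G \<Longrightarrow> has_ac_derivative (f e) (f1 e) (len e)"
    and f2: "\<And>e. e \<in> arcs G \<Longrightarrow> has_ac_derivative (f1 e) (f2 e) (len e)"
    unfolding f2_def using weak_solution_regular[OF wf] by metis
  have "in_Lp G len 2 (\<lambda>e x. \<mu> * f e x)"
    unfolding in_Lp_def
  proof (intro ballI conjI)
    fix e assume e: "e \<in> arcs G"
    show "(\<lambda>x. \<mu> * f e x) \<in> borel_measurable (lebesgue_on {0..len e})"
      by (intro continuous_imp_measurable_on_sets_lebesgue continuous_intros cf e) auto
    have "integrable (lebesgue_on {0..len e}) (\<lambda>x. \<bar>\<mu> * f e x\<bar> ^ 2)"
      by (intro continuous_imp_integrable_real continuous_intros cf e)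
    then show "if (2::ereal) = \<infinity> then \<exists>C. AE x in lebesgue_on {0..len e}. \<bar>\<mu> * f e x\<bar> \<le> C
        else integrable (lebesgue_on {0..len e}) (\<lambda>x. \<bar>\<mu> * f e x\<bar> powr real_of_ereal 2)"
      by (simp add: powr_numeral)
  qed
  moreover have "outgoing_derivative_sum G len f1 v = real_of_ereal (\<alpha> v) * \<phi> v"
    if v: "v \<in> verts G" "\<alpha> v \<noteq> \<infinity>" for v
  proof -
    \<comment> \<open>Zero at all Dirichlet vertices, because \<open>v\<close> is not one of them.
      On a loop the end values agree and the slope \<open>d e\<close> is \<open>0\<close>.\<close>
    define \<psi> where "\<psi> u = (if u = v then 1 else 0 :: real)" for u
    define d where "d e = (\<psi> (head G e) - \<psi> (tail G e)) / len e" for e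
    define g where "g = (\<lambda>e x. \<psi> (tail G e) + d e * x)"
    have g: "admissible g (\<lambda>e x. d e) \<psi>"
      using len_pos v unfolding admissible_def g_def d_def \<psi>_def
      by (auto intro!: derivative_eq_intros simp: less_imp_neq[symmetric])
    have "(\<Sum>e\<in>arcs G. f e (len e) * d e - f e 0 * d e - integral {0..len e} (\<lambda>x. f e x * 0))
        + edge_form q f g + vertex_form \<phi> \<psi> = \<mu> * l2_form f g"
      by (rule weak_solutionD[OF wf g]) auto
    moreover have "edge_form q f g - \<mu> * l2_form f g = (\<Sum>e\<in>arcs G. integral {0..len e} (\<lambda>x. f2 e x * g e x))"
      unfolding f2_def by (intro edge_form_potential[symmetric] cf admissible_continuous[OF g])
    \<comment> \<open>The terms with \<open>d e\<close> will cancel the boundary terms of the weak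
      equation.\<close>
    moreover have "(\<Sum>e\<in>arcs G. integral {0..len e} (\<lambda>x. f2 e x * g e x))
        = (\<Sum>e\<in>arcs G. (f1 e (len e) * \<psi> (head G e) - f1 e 0 * \<psi> (tail G e)) - (f e (len e) * d e - f e 0 * d e))"
    proof (intro sum.cong refl)
      fix e assume e: "e \<in> arcs G"
      note l = len_pos[OF e]
      have "integral {0..len e} (\<lambda>x. f2 e x * g e x)
          = f1 e (len e) * g e (len e) - f1 e 0 * g e 0 - integral {0..len e} (\<lambda>x. f1 e x * d e)"
        by (rule integration_by_parts_ac[OF _ has_ac_derivativeD[OF f2[OF e]]])
          (use l in \<open>auto simp: g_def intro!: derivative_eq_intros\<close>)
      moreover have "g e 0 = \<psi> (tail G e)" "g e (len e) = \<psi> (head G e)"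
        using l by (auto simp: g_def d_def)
      moreover have "integral {0..len e} (f1 e) = f e (len e) - f e 0"
        using has_ac_derivativeD(2)[OF f1[OF e], of "len e"] l by simp
      ultimately show "integral {0..len e} (\<lambda>x. f2 e x * g e x)
          = (f1 e (len e) * \<psi> (head G e) - f1 e 0 * \<psi> (tail G e)) - (f e (len e) * d e - f e 0 * d e)"
        by (simp add: left_diff_distrib)
    qed
    moreover have "vertex_form \<phi> \<psi> = real_of_ereal (\<alpha> v) * \<phi> v"
      using v by (simp add: vertex_form_def \<psi>_def if_distrib[of "\<lambda>x. _ * x"] cong: if_cong)
    moreover have "outgoing_derivative_sum G len f1 v = (\<Sum>v\<in>verts G. \<psi> v * outgoing_derivative_sum G len f1 v)"
      using v by (simp add: \<psi>_def if_distrib[of "\<lambda>x. x * _"] cong: if_cong)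
    ultimately show ?thesis
      by (simp add: sum_verts_outgoing_derivative_sum sum_subtractf mult.commute)
  qed
  moreover have "\<phi> v = 0" if "v \<in> verts G" "\<alpha> v = \<infinity>" for v
    using wf that by (auto simp: weak_solution_def)
  moreover have "\<mu> * f e x = - f2 e x + q e x * f e x" for e x
    by (simp add: f2_def algebra_simps)
  ultimately show ?thesis
    unfolding schroedinger_def using f1 f2 ends
    by (intro conjI exI[of _ f1] exI[of _ f2] exI[of _ \<phi>]) auto
qed

text \<open>The derivative of an eigenfunction is absolutely continuous, hence continuous, so the
  eigenfunction takes part in the minimisation; integrating its equation against itself shows that
  its Rayleigh quotient is \<mu>.\<close>

lemma ground_energy_le_eigenvalue:
  assumes "schroedinger_eigenvalue G len \<alpha> q \<mu>"
  shows "ground_energy \<le> \<mu>"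
proof -
  obtain f e0 x0 where S: "schroedinger G len \<alpha> q f (\<lambda>e x. \<mu> * f e x)"
    and nz: "e0 \<in> arcs G" "x0 \<in> {0..len e0}" "f e0 x0 \<noteq> 0"
    using assms unfolding schroedinger_eigenvalue_def by (elim exE conjE bexE)
  obtain f1 f2 \<phi> where
    arc: "\<forall>e\<in>arcs G. has_ac_derivative (f e) (f1 e) (len e) \<and> has_ac_derivative (f1 e) (f2 e) (len e) \<and>
        (AE x in lebesgue_on {0..len e}. \<mu> * f e x = - f2 e x + q e x * f e x) \<and>
        f e 0 = \<phi> (tail G e) \<and> f e (len e) = \<phi> (head G e)"
    and vert: "\<forall>v\<in>verts G. if \<alpha> v = \<infinity> then \<phi> v = 0
      else outgoing_derivative_sum G len f1 v = real_of_ereal (\<alpha> v) * \<phi> v"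
    using S unfolding schroedinger_def by (elim exE conjE)
  have f1: "has_ac_derivative (f e) (f1 e) (len e)" and f2: "has_ac_derivative (f1 e) (f2 e) (len e)"
    and eq: "AE x in lebesgue_on {0..len e}. \<mu> * f e x = - f2 e x + q e x * f e x"
    and ends: "f e 0 = \<phi> (tail G e)" "f e (len e) = \<phi> (head G e)" if "e \<in> arcs G" for e
    using bspec[OF arc that] by simp_all
  have cf1: "continuous_on {0..len e} (f1 e)" if "e \<in> arcs G" for e
    by (rule has_ac_derivative_imp_continuous[OF f2[OF that]])
  note df = has_ac_derivative_imp_has_real_derivative[OF f1 cf1]
  have adm: "admissible f f1 \<phi>"
    unfolding admissible_def using vert by (auto intro: df cf1 ends)
  note cf = admissible_continuous(1)[OF adm]
  have parts: "integral {0..len e} (\<lambda>x. (q e x - \<mu>) * f e x * f e x)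
      = (f1 e (len e) * \<phi> (head G e) - f1 e 0 * \<phi> (tail G e)) - integral {0..len e} (\<lambda>x. f1 e x * f1 e x)"
    if e: "e \<in> arcs G" for e
  proof -
    have i2: "f2 e absolutely_integrable_on {0..len e}" using f2[OF e] by (simp add: has_ac_derivative_def)
    have "integral {0..len e} (\<lambda>x. (q e x - \<mu>) * f e x * f e x) = integral {0..len e} (\<lambda>x. f2 e x * f e x)"
    proof (rule integral_cong_AE_lebesgue_on)
      show "AE x in lebesgue_on {0..len e}. (q e x - \<mu>) * f e x * f e x = f2 e x * f e x"
        using eq[OF e]
      proof eventually_elim
        case (elim x)
        then have "(q e x - \<mu>) * f e x = f2 e x" by (simp add: algebra_simps)
        then show ?case by simp
      qed
    qed (simp_all add: absolutely_integrable_mult_continuous potential_integrable e cf i2)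
    also have "\<dots> = f1 e (len e) * f e (len e) - f1 e 0 * f e 0 - integral {0..len e} (\<lambda>x. f1 e x * f1 e x)"
      by (rule integration_by_parts_ac[OF _ has_ac_derivativeD[OF f2[OF e]] df[OF e] cf1[OF e]])
        (use len_pos[OF e] e in auto)
    finally show ?thesis by (simp add: ends e)
  qed
  have "edge_form q f f - \<mu> * l2_form f f
      = (\<Sum>e\<in>arcs G. (f1 e (len e) * \<phi> (head G e) - f1 e 0 * \<phi> (tail G e))) - l2_form f1 f1"
    by (subst edge_form_potential[OF cf cf, symmetric]) (simp_all add: parts edge_form_def sum_subtractf)
  \<comment> \<open>The sign changes because the outgoing derivative is \<open>f1 e 0\<close> at the
    tail but \<open>- f1 e (len e)\<close> at the head.\<close>
  moreover have "(\<Sum>e\<in>arcs G. (f1 e (len e) * \<phi> (head G e) - f1 e 0 * \<phi> (tail G e)))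
      = - (\<Sum>v\<in>verts G. \<phi> v * outgoing_derivative_sum G len f1 v)"
    by (simp add: sum_verts_outgoing_derivative_sum sum_negf[symmetric] mult.commute)
  moreover have "(\<Sum>v\<in>verts G. \<phi> v * outgoing_derivative_sum G len f1 v) = vertex_form \<phi> \<phi>"
    unfolding vertex_form_def
  proof (intro sum.cong refl)
    \<comment> \<open>At a Dirichlet vertex both sides are zero since \<open>\<phi> v = 0\<close>;
      elsewhere this is the vertex condition.\<close>
    fix v assume "v \<in> verts G"
    from bspec[OF vert this] show "\<phi> v * outgoing_derivative_sum G len f1 v = real_of_ereal (\<alpha> v) * (\<phi> v * \<phi> v)"
      by (auto split: if_splits)
  qed
  ultimately have "energy f f1 \<phi> f f1 \<phi> = \<mu> * l2_form f f"
    by (simp add: energy_def)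
  then have "ground_energy * l2_form f f \<le> \<mu> * l2_form f f"
    using ground_energy_le[OF adm] by simp
  moreover have "0 < l2_form f f" by (rule l2_form_pos[OF cf nz])
  ultimately show ?thesis by simp
qed

section \<open>The least eigenvalue and its estimate by the sine function\<close>

lemma lambda1_eq_ground_energy: "lambda1 G len \<alpha> q = ground_energy"
  unfolding lambda1_def
proof (rule Least_equality)
  obtain f \<phi> where f: "weak_solution ground_energy f \<phi>" "l2_form f f = 1"
    by (rule ground_state_exists)
  \<comment> \<open>Norm one survives in the limit and excludes the zero function.\<close>
  have "\<exists>e\<in>arcs G. \<exists>x\<in>{0..len e}. f e x \<noteq> 0"
  proof (rule ccontr)
    assume "\<not> ?thesis"
    then have "integral {0..len e} (\<lambda>x. f e x * f e x) = integral {0..len e} (\<lambda>_. 0)" if "e \<in> arcs G" for e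
      using that by (intro Henstock_Kurzweil_Integration.integral_cong) auto
    then show False using f(2) by (simp add: edge_form_def)
  qed
  then show "schroedinger_eigenvalue G len \<alpha> q ground_energy"
    unfolding schroedinger_eigenvalue_def
    by (intro exI[of _ f] conjI weak_solution_imp_schroedinger[OF f(1)])
qed (rule ground_energy_le_eigenvalue)

lemma lambda1_le_sine_fun:
  assumes e0: "e0 \<in> arcs G"
  shows "lambda1 G len \<alpha> q
    \<le> (pi / len e0)\<^sup>2 + (2 / len e0) * integral {0..len e0} (\<lambda>x. q e0 x * (sin (pi * x / len e0))\<^sup>2)"
proof -
  let ?I = "integral {0..len e0} (\<lambda>x. q e0 x * (sin (pi * x / len e0))\<^sup>2)"
  have "edge_form q (sine_fun e0) (sine_fun e0) = ?I"
    by (subst edge_form_eq_single[OF e0]) (auto simp: sine_fun_def power2_eq_square)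
  moreover have "vertex_form (\<lambda>_. 0) (\<lambda>_. 0) = 0" by (simp add: vertex_form_def)
  ultimately have "lambda1 G len \<alpha> q * (len e0 / 2) \<le> (pi / len e0)\<^sup>2 * (len e0 / 2) + ?I"
    using ground_energy_le[OF sine_fun_admissible[OF e0]]
    by (simp add: lambda1_eq_ground_energy energy_def sine_fun_l2_form[OF e0])
  moreover have "a \<le> c + (2 / l) * I" if "a * (l / 2) \<le> c * (l / 2) + I" "0 < l" for a c l I :: real
    using that by (simp add: field_simps)
  ultimately show ?thesis using len_pos[OF e0] by blast
qed

end

section \<open>The eigenvalue bound\<close>

lemma finite_measure_lebesgue_on_Icc: "finite_measure (lebesgue_on {a..b::real})"
  by (rule finite_measureI, cases "a \<le> b") (simp_all add: emeasure_restrict_space)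

lemma abs_le_one_plus_powr:
  fixes x p :: real
  assumes "1 \<le> p"
  shows "\<bar>x\<bar> \<le> 1 + \<bar>x\<bar> powr p"
proof (cases "\<bar>x\<bar> \<le> 1")
  case False
  then have "\<bar>x\<bar> powr 1 \<le> \<bar>x\<bar> powr p" using assms by (intro powr_mono) auto
  then show ?thesis using False by simp
qed (simp add: add_increasing2)

text \<open>Edges have finite measure: an essentially bounded function is integrable, and for finite
  \<open>p\<close> the function is dominated by \<open>1\<close> plus its \<open>p\<close>-th
  power.\<close>

lemma in_Lp_imp_absolutely_integrable:
  assumes p: "1 \<le> p" and q: "in_Lp G len p q" and e: "e \<in> arcs G"
  shows "q e absolutely_integrable_on {0..len e}"
proof -
  interpret finite_measure "lebesgue_on {0..len e}" by (rule finite_measure_lebesgue_on_Icc)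
  have meas: "q e \<in> borel_measurable (lebesgue_on {0..len e})"
    using q e by (simp add: in_Lp_def)
  have "integrable (lebesgue_on {0..len e}) (\<lambda>x. \<bar>q e x\<bar>)"
  proof (cases "p = \<infinity>")
    case True
    then obtain C where "AE x in lebesgue_on {0..len e}. \<bar>q e x\<bar> \<le> C"
      using q e by (auto simp: in_Lp_def)
    then show ?thesis using meas by (intro integrable_const_bound[of _ C]) auto
  next
    case False
    then obtain P where P: "p = ereal P" "1 \<le> P" using p by (cases p) auto
    have "integrable (lebesgue_on {0..len e}) (\<lambda>x. 1 + \<bar>q e x\<bar> powr P)"
      using q e P by (intro Bochner_Integration.integrable_add) (auto simp: in_Lp_def)
    then show ?thesis
    proof (rule Bochner_Integration.integrable_bound)
      show "AE x in lebesgue_on {0..len e}. norm \<bar>q e x\<bar> \<le> norm (1 + \<bar>q e x\<bar> powr P)"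
        using abs_le_one_plus_powr[OF P(2)] by (intro AE_I2) auto
    qed (use meas in simp)
  qed
  then show ?thesis using meas by (simp add: absolutely_integrable_measurable_real)
qed

text \<open>The sum of the edgewise essential bounds, taken in absolute value, works on all edges.
  Nonemptiness is what lets lower bounds pass to the \<open>Inf\<close> in the norm.\<close>

lemma (in metric_graph) Lp_norm_infinity_set_nonempty:
  assumes q: "in_Lp G len \<infinity> q"
  shows "{C. 0 \<le> C \<and> (\<forall>e\<in>arcs G. AE x in lebesgue_on {0..len e}. \<bar>max (q e x) 0\<bar> \<le> C)} \<noteq> {}"
proof -
  have "\<exists>C. \<forall>e\<in>arcs G. AE x in lebesgue_on {0..len e}. \<bar>q e x\<bar> \<le> C e"
    using q by (intro bchoice) (auto simp: in_Lp_def)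
  then obtain C where C: "\<And>e. e \<in> arcs G \<Longrightarrow> AE x in lebesgue_on {0..len e}. \<bar>q e x\<bar> \<le> C e"
    by blast
  have "AE x in lebesgue_on {0..len e}. \<bar>max (q e x) 0\<bar> \<le> (\<Sum>e\<in>arcs G. \<bar>C e\<bar>)" if e: "e \<in> arcs G" for e
  proof -
    have "\<bar>C e\<bar> \<le> (\<Sum>e\<in>arcs G. \<bar>C e\<bar>)"
      by (rule member_le_sum[OF e]) auto
    with C[OF e] show ?thesis by (auto elim!: eventually_mono)
  qed
  then show ?thesis by (auto intro!: exI[of _ "\<Sum>e\<in>arcs G. \<bar>C e\<bar>"] sum_nonneg)
qed

lemma (in metric_graph) Lp_norm_pos_part_nonneg:
  assumes "in_Lp G len p q"
  shows "0 \<le> Lp_norm G len p (\<lambda>e x. max (q e x) 0)"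
proof (cases "p = \<infinity>")
  case True
  have "0 \<le> Inf {C. 0 \<le> C \<and> (\<forall>e\<in>arcs G. AE x in lebesgue_on {0..len e}. \<bar>max (q e x) 0\<bar> \<le> C)}"
    by (rule cInf_greatest[OF Lp_norm_infinity_set_nonempty]) (use assms True in auto)
  then show ?thesis using True by (simp add: Lp_norm_def)
qed (simp add: Lp_norm_def)

text \<open>Dropping the negative part of \<open>q\<close> only enlarges the integral. What remains
  is a mean of the positive part for a probability density: it lies below every essential bound, and
  for finite \<open>p\<close> Jensen's inequality applies.\<close>

lemma (in metric_graph) sine_weighted_mean_le_Lp_norm:
  assumes p: "1 \<le> p" and q: "in_Lp G len p q" and e0: "e0 \<in> arcs G"
  shows "(2 / len e0) * integral {0..len e0} (\<lambda>x. q e0 x * (sin (pi * x / len e0))\<^sup>2)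
    \<le> (2 / len e0) powr real_of_ereal (1 / p) * Lp_norm G len p (\<lambda>e x. max (q e x) 0)"
proof -
  define l where "l = len e0"
  have l: "0 < l" unfolding l_def by (rule len_pos[OF e0])
  define w where "w = (\<lambda>x. (sin (pi * x / l))\<^sup>2)"
  define r where "r = (\<lambda>e x. max (q e x) 0)"
  have cw: "continuous_on {0..l} w" unfolding w_def using l by (intro continuous_intros) auto
  have w01: "0 \<le> w x" "w x \<le> 1" for x by (auto simp: w_def abs_square_le_1)
  have W: "(w has_integral l / 2) {0..l}" unfolding w_def by (rule has_integral_sin_square[OF l])
  have qi: "q e0 absolutely_integrable_on {0..l}"
    unfolding l_def by (rule in_Lp_imp_absolutely_integrable[OF p q e0])
  have ri: "r e0 absolutely_integrable_on {0..l}"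
    unfolding r_def using qi by (intro absolutely_integrable_max_1) auto
  note rwi = absolutely_integrable_mult_continuous[OF ri cw]
  have qr: "integral {0..l} (\<lambda>x. q e0 x * w x) \<le> integral {0..l} (\<lambda>x. r e0 x * w x)"
    by (intro integral_le integrable_mult_continuous qi ri cw mult_right_mono w01) (simp add: r_def)
  have "(2 / l) * integral {0..l} (\<lambda>x. r e0 x * w x) \<le> (2 / l) powr real_of_ereal (1 / p) * Lp_norm G len p r"
  proof (cases "p = \<infinity>")
    case True
    have "(2 / l) * integral {0..l} (\<lambda>x. r e0 x * w x) \<le> C"
      if C: "0 \<le> C" "\<forall>e\<in>arcs G. AE x in lebesgue_on {0..len e}. \<bar>r e x\<bar> \<le> C" for C
    proof -
      have "AE x in lebesgue_on {0..l}. \<bar>r e0 x\<bar> \<le> C" unfolding l_def using C(2) e0 by blast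
      then have "AE x in lebesgue_on {0..l}. r e0 x * w x \<le> C * w x"
        by eventually_elim (simp add: mult_right_mono w01)
      moreover have Cw: "(\<lambda>x. C * w x) absolutely_integrable_on {0..l}"
        by (intro absolutely_integrable_continuous_real continuous_intros cw)
      ultimately have "integral {0..l} (\<lambda>x. r e0 x * w x) \<le> integral {0..l} (\<lambda>x. C * w x)"
        using rwi by (intro integral_mono_AE_lebesgue_on) auto
      also have "\<dots> = C * (l / 2)" using W by (simp add: integral_unique)
      finally show ?thesis using l by (simp add: field_simps)
    qed
    then have "(2 / l) * integral {0..l} (\<lambda>x. r e0 x * w x)
        \<le> Inf {C. 0 \<le> C \<and> (\<forall>e\<in>arcs G. AE x in lebesgue_on {0..len e}. \<bar>r e x\<bar> \<le> C)}"
      unfolding r_def using q True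
      by (intro cInf_greatest Lp_norm_infinity_set_nonempty) blast+
    then have "(2 / l) * integral {0..l} (\<lambda>x. r e0 x * w x) \<le> Lp_norm G len p r"
      using True by (simp add: Lp_norm_def)
    \<comment> \<open>For infinite \<open>p\<close> the exponent \<open>1 / p\<close> is
      \<open>0\<close>, so the factor in front of the norm is \<open>1\<close>.\<close>
    then show ?thesis using True l by simp
  next
    case False
    then obtain P where P: "p = ereal P" "1 \<le> P" using p by (cases p) auto
    have rp: "integrable (lebesgue_on {0..len e}) (\<lambda>x. \<bar>r e x\<bar> powr P)" if e: "e \<in> arcs G" for e
    proof (rule Bochner_Integration.integrable_bound)
      show "integrable (lebesgue_on {0..len e}) (\<lambda>x. \<bar>q e x\<bar> powr P)"
        using q e P by (auto simp: in_Lp_def)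
      have [measurable]: "q e \<in> borel_measurable (lebesgue_on {0..len e})"
        using q e by (simp add: in_Lp_def)
      show "(\<lambda>x. \<bar>r e x\<bar> powr P) \<in> borel_measurable (lebesgue_on {0..len e})"
        unfolding r_def by measurable
      show "AE x in lebesgue_on {0..len e}. norm (\<bar>r e x\<bar> powr P) \<le> norm (\<bar>q e x\<bar> powr P)"
        using P by (intro AE_I2) (auto simp: r_def intro!: powr_mono2)
    qed
    have r0: "0 \<le> r e x" for e x by (simp add: r_def)
    define I where "I e = (LINT x|lebesgue_on {0..len e}. \<bar>r e x\<bar> powr P)" for e
    have I0: "0 \<le> I e" for e unfolding I_def by (intro integral_nonneg_AE AE_I2) auto
    have Ie0: "I e0 = integral {0..l} (\<lambda>x. r e0 x powr P)"
      unfolding I_def l_def using lebesgue_integral_eq_integral[OF rp[OF e0]] r0 by simp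
    \<comment> \<open>The factor is written as \<open>1 / W\<close>, where \<open>W = l / 2\<close>
      is the total weight.\<close>
    have "(2 / l) * integral {0..l} (\<lambda>x. r e0 x * w x)
        = (1 / (l / 2)) * integral {0..l} (\<lambda>x. r e0 x * w x)" by simp
    also have "\<dots> \<le> ((1 / (l / 2)) * integral {0..l} (\<lambda>x. r e0 x powr P)) powr (1 / P)"
    proof (rule weighted_mean_le_powr[OF P(2) ri r0 _ cw w01 W])
      show "(\<lambda>x. r e0 x powr P) integrable_on {0..l}"
        using integrable_on_lebesgue_on[OF rp[OF e0]] r0 by (simp add: l_def)
    qed (use l in auto)
    also have "\<dots> = ((2 / l) * I e0) powr (1 / P)" by (simp add: Ie0)
    \<comment> \<open>The integral over \<open>e0\<close> is one of the nonnegative summands in the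
      norm over the whole graph.\<close>
    also have "\<dots> \<le> ((2 / l) * (\<Sum>e\<in>arcs G. I e)) powr (1 / P)"
      using l P I0 e0 by (intro powr_mono2 mult_left_mono member_le_sum mult_nonneg_nonneg) auto
    also have "\<dots> = (2 / l) powr (1 / P) * (\<Sum>e\<in>arcs G. I e) powr (1 / P)"
      by (rule powr_mult)
    also have "\<dots> = (2 / l) powr real_of_ereal (1 / p) * Lp_norm G len p r"
      using P by (simp add: Lp_norm_def I_def one_ereal_def)
    finally show ?thesis .
  qed
  moreover have "(2 / l) * integral {0..l} (\<lambda>x. q e0 x * w x) \<le> (2 / l) * integral {0..l} (\<lambda>x. r e0 x * w x)"
    using l qr by (intro mult_left_mono) auto
  ultimately show ?thesis by (simp add: l_def w_def r_def)
qed

theorem theorem1p2: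
  fixes G :: "('v, 'e) pre_digraph"
    and len :: "'e \<Rightarrow> real"
    and p :: ereal
    and q :: "'e \<Rightarrow> real \<Rightarrow> real"
    and \<alpha> :: "'v \<Rightarrow> ereal"
  assumes "metric_graph G len"
    and "1 \<le> p"
    and "in_Lp G len p q"
    and "\<And>v. v \<in> verts G \<Longrightarrow> \<alpha> v \<noteq> - \<infinity>"
  shows "lambda1 G len \<alpha> q
      \<le> (2 / max_length G len) powr real_of_ereal (1 / p) * Lp_norm G len p (\<lambda>e x. max (q e x) 0)
        + (pi / max_length G len)\<^sup>2
    \<and> lambda1 G len \<alpha> q
      \<le> (2 * real (card (arcs G)) / total_length G len) powr real_of_ereal (1 / p)
          * Lp_norm G len p (\<lambda>e x. max (q e x) 0)
        + (pi * real (card (arcs G)) / total_length G len)\<^sup>2"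
proof -
  interpret metric_graph G len by fact
  interpret schroedinger_graph G len \<alpha> q
    by unfold_locales (rule in_Lp_imp_absolutely_integrable[OF assms(2,3)])
  define N where "N = Lp_norm G len p (\<lambda>e x. max (q e x) 0)"
  have N0: "0 \<le> N" unfolding N_def by (rule Lp_norm_pos_part_nonneg[OF assms(3)])
  have "max_length G len \<in> len ` arcs G"
    unfolding max_length_def by (intro Max_in) (auto simp: arcs_nonempty)
  then obtain e0 where e0: "e0 \<in> arcs G" "max_length G len = len e0" by auto
  have first: "lambda1 G len \<alpha> q \<le> (2 / len e0) powr real_of_ereal (1 / p) * N + (pi / len e0)\<^sup>2"
    using lambda1_le_sine_fun[OF e0(1)] sine_weighted_mean_le_Lp_norm[OF assms(2,3) e0(1)]
    by (simp add: N_def)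
  note l = len_pos[OF e0(1)]
  have L: "0 < total_length G len"
    unfolding total_length_def by (intro sum_pos len_pos) (auto simp: arcs_nonempty)
  \<comment> \<open>The average edge length is at most the maximal one.\<close>
  have "total_length G len \<le> real (card (arcs G)) * len e0"
    unfolding total_length_def e0(2)[symmetric] max_length_def
    by (rule sum_bounded_above) simp
  then have "1 / len e0 \<le> real (card (arcs G)) / total_length G len"
    using l L by (simp add: field_simps)
  \<comment> \<open>Applied below with \<open>c = 2\<close> for the factor of the norm and with
    \<open>c = pi\<close> for the kinetic term.\<close>
  from mult_left_mono[OF this]
  have le: "c / len e0 \<le> c * real (card (arcs G)) / total_length G len" if "0 \<le> c" for c
    using that by simp
  have "0 \<le> real_of_ereal (1 / p)"
    using assms(2) by (cases p) (auto simp: one_ereal_def)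
  then have "(2 / len e0) powr real_of_ereal (1 / p) * N
      \<le> (2 * real (card (arcs G)) / total_length G len) powr real_of_ereal (1 / p) * N"
    using le[of 2] l by (intro mult_right_mono N0 powr_mono2) auto
  moreover have "(pi / len e0)\<^sup>2 \<le> (pi * real (card (arcs G)) / total_length G len)\<^sup>2"
    using le[of pi] l by (intro power_mono) auto
  ultimately show ?thesis
    using first unfolding e0(2) N_def[symmetric] by linarith
qed

end
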